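(* Let $(\mathbb{X},f)$ and $(\mathbb{Y},g)$ be Reeb graphs. Then $$d_I(f,g)\;\le\; d_{FD}(f,g)\;\le\; 7\,d_I(f,g),$$ where $d_I$ is the interleaving distance and $d_{FD}$ is the functional distortion distance. In particular, the functional distortion metric and the interleaving metric are strongly equivalent on the space of Reeb graphs.
   Context: **Reeb graphs.** In general, for a space $\mathbb{X}$ with a continuous function $f:\mathbb{X}\to\mathbb{R}$, write $x\sim_f y$ if $x,y$ lie in the same path-connected component of a level set $f^{-1}(a)$, $a\in\mathbb{R}$; the Reeb graph of $(\mathbb{X},f)$ is the quotient $\mathbb{X}/\!\sim_f$ with the real-valued function induced by $f$. Here "a Reeb graph $(\mathbb{X},f)$" means an object of the category of Reeb graphs: a finite graph $\mathbb{X}$, seen as a topological space (a regular CW complex), with a continuous function $f:\mathbb{X}\to\mathbb{R}$ that is monotone on edges. A morphism (function preserving map) $(\mathbb{X},f)\to(\mathbb{Y},g)$ is a continuous map $\phi:\mathbb{X}\to\mathbb{Y}$ with $g\circ\phi=f$. **Smoothing.** For $\varepsilon\ge 0$ let $\mathbb{X}_\varepsilon=\mathbb{X}\times[-\varepsilon,\varepsilon]$ and $f_\varepsilon:\mathbb{X}_\varepsilon\to\mathbb{R}$, $f_\varepsilon(x,t)=f(x)+t$. The $\varepsilon$-smoothing $\mathcal{T}_\varepsilon(\mathbb{X},f)$ is the Reeb graph $\mathbb{X}_\varepsilon/\!\sim_{f_\varepsilon}$ with the function induced by $f_\varepsilon$; it is again a Reeb graph. Write $[x,t]$ for the class of $(x,t)$.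 One identifies $\mathcal{T}_{2\varepsilon}(\mathbb{X},f)\cong\mathcal{T}_\varepsilon(\mathcal{T}_\varepsilon(\mathbb{X},f))$. Let $\iota:(\mathbb{X},f)\to\mathcal{T}_\varepsilon(\mathbb{X},f)$ be $x\mapsto[x,0]$, and let $\iota_\varepsilon:\mathcal{T}_\varepsilon(\mathbb{X},f)\to\mathcal{T}_{2\varepsilon}(\mathbb{X},f)\cong\mathcal{T}_\varepsilon(\mathcal{T}_\varepsilon(\mathbb{X},f))$ be $z\mapsto[z,0]$. The same notation is used for $(\mathbb{Y},g)$. A function preserving map $\phi:(\mathbb{X},f)\to\mathcal{T}_\varepsilon(\mathbb{Y},g)$ induces $\phi_\varepsilon:\mathcal{T}_\varepsilon(\mathbb{X},f)\to\mathcal{T}_\varepsilon(\mathcal{T}_\varepsilon(\mathbb{Y},g))\cong\mathcal{T}_{2\varepsilon}(\mathbb{Y},g)$, $[x,t]\mapsto[\phi(x),t]$ (so $\phi_\varepsilon\circ\iota=\iota_\varepsilon\circ\phi$); similarly $\psi:(\mathbb{Y},g)\to\mathcal{T}_\varepsilon(\mathbb{X},f)$ induces $\psi_\varepsilon:\mathcal{T}_\varepsilon(\mathbb{Y},g)\to\mathcal{T}_{2\varepsilon}(\mathbb{X},f)$. **Interleaving distance.** An $\varepsilon$-interleaving of $(\mathbb{X},f)$ and $(\mathbb{Y},g)$ is a pair of function preserving maps $\phi:(\mathbb{X},f)\to\mathcal{T}_\varepsilon(\mathbb{Y},g)$, $\psi:(\mathbb{Y},g)\to\mathcal{T}_\varepsilon(\mathbb{X},f)$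 with $\psi_\varepsilon\circ\phi=\iota_\varepsilon\circ\iota$ on $\mathbb{X}$ and $\phi_\varepsilon\circ\psi=\iota_\varepsilon\circ\iota$ on $\mathbb{Y}$. Then $d_I(f,g)=\inf\{\varepsilon \mid \text{there exists an } \varepsilon\text{-interleaving of }(\mathbb{X},f)\text{ and }(\mathbb{Y},g)\}$ (with $\inf\emptyset=\infty$). **Functional distortion distance.** For a path $\pi$ in $\mathbb{X}$, $\mathrm{height}(\pi)=\max_{x\in\pi}f(x)-\min_{x\in\pi}f(x)$, and $d_f(u,v)=\min_{\pi}\mathrm{height}(\pi)$ over all paths $\pi$ from $u$ to $v$ in $\mathbb{X}$ ($d_f(u,v)=\infty$ if there is none, and $|\infty-\infty|$ is read as $0$ below); $d_g$ on $\mathbb{Y}$ is defined likewise. For continuous maps $\phi:\mathbb{X}\to\mathbb{Y}$, $\psi:\mathbb{Y}\to\mathbb{X}$ (not required to preserve function values) let $$C(\phi,\psi)=\{(x,y)\in\mathbb{X}\times\mathbb{Y}\mid \phi(x)=y\text{ or }x=\psi(y)\},$$ $$D(\phi,\psi)=\sup_{(x,y),(x',y')\in C(\phi,\psi)}\tfrac12\,|d_f(x,x')-d_g(y,y')|,$$ $$d_{FD}(f,g)=\inf_{\phi,\psi}\max\{D(\phi,\psi),\ \|f-g\circ\phi\|_\infty,\ \|g-f\circ\psi\|_\infty\}.$$ *)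

theory Defs
  imports "HOL-Analysis.Analysis"
begin

section \<open>Finite graphs with a function\<close>

text \<open>A finite regular CW structure of dimension at most one: \<open>V\<close> is the set of 0-cells and
  \<open>E\<close> the set of characteristic maps of the closed 1-cells. Regularity means that these maps are
  embeddings of the closed interval; parallel edges are allowed. Because there are finitely many
  closed cells, each compact in a Hausdorff space, the topology is automatically the weak topology
  determined by the cells.\<close>

definition finite_graph :: "'a topology \<Rightarrow> 'a set \<Rightarrow> (real \<Rightarrow> 'a) set \<Rightarrow> bool" where
  "finite_graph X V E \<longleftrightarrow>
     Hausdorff_space X \<and> finite V \<and> finite E \<and> V \<subseteq> topspace X \<and>
     (\<forall>e\<in>E. embedding_map (top_of_set {0..1}) X e \<and> e 0 \<in> V \<and> e 1 \<in> V \<and>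
            e ` {0<..<1} \<inter> V = {}) \<and>
     (\<forall>e\<in>E. \<forall>e'\<in>E. e \<noteq> e' \<longrightarrow> e ` {0<..<1} \<inter> e' ` {0<..<1} = {}) \<and>
     topspace X = V \<union> (\<Union>e\<in>E. e ` {0..1})"

text \<open>Monotone is meant in the weak sense; strictly monotone functions are included.\<close>

definition reeb_graph :: "'a topology \<Rightarrow> ('a \<Rightarrow> real) \<Rightarrow> bool" where
  "reeb_graph X f \<longleftrightarrow>
     continuous_map X euclideanreal f \<and>
     (\<exists>V E. finite_graph X V E \<and>
        (\<forall>e\<in>E. mono_on {0..1} (f \<circ> e) \<or> antimono_on {0..1} (f \<circ> e)))"

definition function_preserving_map ::
  "'a topology \<Rightarrow> ('a \<Rightarrow> real) \<Rightarrow> 'b topology \<Rightarrow> ('b \<Rightarrow> real) \<Rightarrow> ('a \<Rightarrow> 'b) \<Rightarrow> bool" where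
  "function_preserving_map X f Y g \<phi> \<longleftrightarrow>
     continuous_map X Y \<phi> \<and> (\<forall>x\<in>topspace X. g (\<phi> x) = f x)"


section \<open>Reeb quotients\<close>

definition level_set :: "'a topology \<Rightarrow> ('a \<Rightarrow> real) \<Rightarrow> real \<Rightarrow> 'a set" where
  "level_set X f a = {x \<in> topspace X. f x = a}"

definition reeb_class :: "'a topology \<Rightarrow> ('a \<Rightarrow> real) \<Rightarrow> 'a \<Rightarrow> 'a set" where
  "reeb_class X f x = path_component_of_set (subtopology X (level_set X f (f x))) x"

definition quotient_space :: "'a topology \<Rightarrow> ('a \<Rightarrow> 'b) \<Rightarrow> 'b topology" where
  "quotient_space X q =
     topology (\<lambda>U. U \<subseteq> q ` topspace X \<and> openin X {x \<in> topspace X. q x \<in> U})"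

definition reeb_space :: "'a topology \<Rightarrow> ('a \<Rightarrow> real) \<Rightarrow> 'a set topology" where
  "reeb_space X f = quotient_space X (reeb_class X f)"

text \<open>The function induced on classes; the choice of the representative is immaterial by
  \<open>reeb_fun_class\<close> below.\<close>

definition reeb_fun :: "('a \<Rightarrow> real) \<Rightarrow> 'a set \<Rightarrow> real" where
  "reeb_fun f c = f (SOME x. x \<in> c)"

lemma quotient_map_quotient_space: "quotient_map X (quotient_space X q) q"
proof -
  let ?L = "\<lambda>U. U \<subseteq> q ` topspace X \<and> openin X {x \<in> topspace X. q x \<in> U}"
  have "istopology ?L"
    unfolding istopology_def
  proof (intro conjI allI impI)
    fix S T assume "?L S" "?L T"
    moreover have "{x \<in> topspace X. q x \<in> S \<inter> T} =
        {x \<in> topspace X. q x \<in> S} \<inter> {x \<in> topspace X. q x \<in> T}" by auto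
    ultimately show "S \<inter> T \<subseteq> q ` topspace X" "openin X {x \<in> topspace X. q x \<in> S \<inter> T}"
      by auto
  next
    fix K assume K: "\<forall>S\<in>K. ?L S"
    have "{x \<in> topspace X. q x \<in> \<Union>K} = (\<Union>S\<in>K. {x \<in> topspace X. q x \<in> S})" by auto
    with K show "openin X {x \<in> topspace X. q x \<in> \<Union>K}" by auto
    from K show "\<Union>K \<subseteq> q ` topspace X" by blast
  qed
  then have op: "openin (quotient_space X q) = ?L"
    by (simp add: quotient_space_def)
  have "{x \<in> topspace X. q x \<in> q ` topspace X} = topspace X" by auto
  then have "openin (quotient_space X q) (q ` topspace X)" by (simp add: op)
  then have "topspace (quotient_space X q) = q ` topspace X"
    by (metis (no_types, lifting) op openin_subset openin_topspace subset_antisym)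
  then show ?thesis by (simp add: quotient_map_def op)
qed

lemma quotient_map_reeb_class: "quotient_map X (reeb_space X f) (reeb_class X f)"
  by (simp add: reeb_space_def quotient_map_quotient_space)

lemma reeb_class_self: "x \<in> topspace X \<Longrightarrow> x \<in> reeb_class X f x"
  by (simp add: reeb_class_def path_component_of_refl level_set_def)

lemma reeb_classD:
  assumes "y \<in> reeb_class X f x"
  shows "y \<in> topspace X" "f y = f x" "reeb_class X f y = reeb_class X f x"
proof -
  have p: "path_component_of (subtopology X (level_set X f (f x))) x y"
    using assms by (simp add: reeb_class_def)
  then have "y \<in> topspace (subtopology X (level_set X f (f x)))"
    by (meson path_component_in_topspace)
  then show "y \<in> topspace X" and fy: "f y = f x"
    by (auto simp: level_set_def)
  show "reeb_class X f y = reeb_class X f x"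
    unfolding reeb_class_def fy using p
    by (auto intro: path_component_of_trans path_component_of_sym)
qed

lemma reeb_fun_class: "x \<in> topspace X \<Longrightarrow> reeb_fun f (reeb_class X f x) = f x"
  unfolding reeb_fun_def by (metis reeb_classD(2) reeb_class_self someI)


section \<open>Smoothing\<close>

definition thickening :: "real \<Rightarrow> 'a topology \<Rightarrow> ('a \<times> real) topology" where
  "thickening \<epsilon> X = prod_topology X (top_of_set {-\<epsilon>..\<epsilon>})"

definition thick_fun :: "('a \<Rightarrow> real) \<Rightarrow> 'a \<times> real \<Rightarrow> real" where
  "thick_fun f = (\<lambda>(x, t). f x + t)"

definition smooth_space :: "real \<Rightarrow> 'a topology \<Rightarrow> ('a \<Rightarrow> real) \<Rightarrow> ('a \<times> real) set topology" where
  "smooth_space \<epsilon> X f = reeb_space (thickening \<epsilon> X) (thick_fun f)"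

definition smooth_fun :: "('a \<Rightarrow> real) \<Rightarrow> ('a \<times> real) set \<Rightarrow> real" where
  "smooth_fun f = reeb_fun (thick_fun f)"

definition smooth_class ::
  "real \<Rightarrow> 'a topology \<Rightarrow> ('a \<Rightarrow> real) \<Rightarrow> 'a \<times> real \<Rightarrow> ('a \<times> real) set" where
  "smooth_class \<epsilon> X f = reeb_class (thickening \<epsilon> X) (thick_fun f)"

text \<open>The map \<open>x \<mapsto> [x, 0]\<close> into the smoothing of \<open>(X, f)\<close>. Applied to the smoothing itself, that
  is to \<open>smooth_space \<epsilon> X f\<close> and \<open>smooth_fun f\<close>, it is \<open>z \<mapsto> [z, 0]\<close>.\<close>

definition smooth_incl :: "real \<Rightarrow> 'a topology \<Rightarrow> ('a \<Rightarrow> real) \<Rightarrow> 'a \<Rightarrow> ('a \<times> real) set" where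
  "smooth_incl \<epsilon> X f x = smooth_class \<epsilon> X f (x, 0)"

text \<open>For a function preserving map \<open>\<phi>\<close> into \<open>(Z, h)\<close>, the map \<open>[x, t] \<mapsto> [\<phi> x, t]\<close> between the
  smoothings; independence of the representative is \<open>smooth_map_class\<close> below.\<close>

definition smooth_map ::
  "real \<Rightarrow> 'b topology \<Rightarrow> ('b \<Rightarrow> real) \<Rightarrow> ('a \<Rightarrow> 'b) \<Rightarrow> ('a \<times> real) set \<Rightarrow> ('b \<times> real) set" where
  "smooth_map \<epsilon> Z h \<phi> c = (case (SOME p. p \<in> c) of (x, t) \<Rightarrow> smooth_class \<epsilon> Z h (\<phi> x, t))"

lemma smooth_map_class:
  assumes fp: "function_preserving_map X f Z h \<phi>" and x: "x \<in> topspace X" and t: "t \<in> {-\<epsilon>..\<epsilon>}"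
  shows "smooth_map \<epsilon> Z h \<phi> (smooth_class \<epsilon> X f (x, t)) = smooth_class \<epsilon> Z h (\<phi> x, t)"
proof -
  let ?c = "smooth_class \<epsilon> X f (x, t)"
  let ?F = "\<lambda>p. (\<phi> (fst p), snd p)"
  let ?L = "level_set (thickening \<epsilon> X) (thick_fun f) (f x + t)"
  let ?M = "level_set (thickening \<epsilon> Z) (thick_fun h) (f x + t)"
  have cont: "continuous_map X Z \<phi>" and pres: "\<And>x. x \<in> topspace X \<Longrightarrow> h (\<phi> x) = f x"
    using fp by (auto simp: function_preserving_map_def)
  obtain y s where ys: "(SOME p. p \<in> ?c) = (y, s)" by fastforce
  have "(x, t) \<in> ?c"
    using x t by (simp add: smooth_class_def reeb_class_self thickening_def)
  then have "(y, s) \<in> ?c" by (metis someI ys)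
  then obtain g where g: "pathin (subtopology (thickening \<epsilon> X) ?L) g" "g 0 = (x, t)" "g 1 = (y, s)"
    by (auto simp: smooth_class_def reeb_class_def path_component_of_def thick_fun_def)
  have "continuous_map (thickening \<epsilon> X) (thickening \<epsilon> Z) ?F"
    unfolding thickening_def
    by (intro continuous_map_pairedI continuous_map_compose[OF continuous_map_fst cont, unfolded o_def]
        continuous_map_snd)
  moreover have "?F ` (topspace (thickening \<epsilon> X) \<inter> ?L) \<subseteq> ?M"
    using pres cont
    by (auto simp: level_set_def thickening_def thick_fun_def continuous_map_def)
  ultimately have "continuous_map (subtopology (thickening \<epsilon> X) ?L) (subtopology (thickening \<epsilon> Z) ?M) ?F"
    by (auto simp: continuous_map_in_subtopology intro: continuous_map_from_subtopology)
  then have "pathin (subtopology (thickening \<epsilon> Z) ?M) (?F \<circ> g)"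
    using g(1) unfolding pathin_def by (rule continuous_map_compose[rotated])
  then have "path_component_of (subtopology (thickening \<epsilon> Z) ?M) (\<phi> x, t) (\<phi> y, s)"
    unfolding path_component_of_def using g by (intro exI[of _ "?F \<circ> g"]) auto
  then have "(\<phi> y, s) \<in> smooth_class \<epsilon> Z h (\<phi> x, t)"
    by (simp add: smooth_class_def reeb_class_def thick_fun_def pres[OF x])
  then have "smooth_class \<epsilon> Z h (\<phi> y, s) = smooth_class \<epsilon> Z h (\<phi> x, t)"
    unfolding smooth_class_def by (rule reeb_classD(3))
  then show ?thesis by (simp add: smooth_map_def ys)
qed


section \<open>Interleaving distance\<close>

text \<open>The \<open>2\<epsilon>\<close>-smoothing is identified with the twice \<open>\<epsilon>\<close>-smoothed space by
  \<open>[x, s + t] \<mapsto> [[x, s], t]\<close>; both commutativity conditions are equations in the latter.\<close>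

definition interleaving ::
  "real \<Rightarrow> 'a topology \<Rightarrow> ('a \<Rightarrow> real) \<Rightarrow> 'b topology \<Rightarrow> ('b \<Rightarrow> real) \<Rightarrow>
   ('a \<Rightarrow> ('b \<times> real) set) \<Rightarrow> ('b \<Rightarrow> ('a \<times> real) set) \<Rightarrow> bool" where
  "interleaving \<epsilon> X f Y g \<phi> \<psi> \<longleftrightarrow>
     function_preserving_map X f (smooth_space \<epsilon> Y g) (smooth_fun g) \<phi> \<and>
     function_preserving_map Y g (smooth_space \<epsilon> X f) (smooth_fun f) \<psi> \<and>
     (\<forall>x\<in>topspace X. smooth_map \<epsilon> (smooth_space \<epsilon> X f) (smooth_fun f) \<psi> (\<phi> x) =
        smooth_incl \<epsilon> (smooth_space \<epsilon> X f) (smooth_fun f) (smooth_incl \<epsilon> X f x)) \<and>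
     (\<forall>y\<in>topspace Y. smooth_map \<epsilon> (smooth_space \<epsilon> Y g) (smooth_fun g) \<phi> (\<psi> y) =
        smooth_incl \<epsilon> (smooth_space \<epsilon> Y g) (smooth_fun g) (smooth_incl \<epsilon> Y g y))"

definition interleaving_dist ::
  "'a topology \<Rightarrow> ('a \<Rightarrow> real) \<Rightarrow> 'b topology \<Rightarrow> ('b \<Rightarrow> real) \<Rightarrow> ennreal" where
  "interleaving_dist X f Y g =
     (INF \<epsilon>\<in>{\<epsilon>. 0 \<le> \<epsilon> \<and> (\<exists>\<phi> \<psi>. interleaving \<epsilon> X f Y g \<phi> \<psi>)}. ennreal \<epsilon>)"


section \<open>Functional distortion distance\<close>

definition path_height :: "('a \<Rightarrow> real) \<Rightarrow> (real \<Rightarrow> 'a) \<Rightarrow> real" where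
  "path_height f \<gamma> = (SUP s\<in>{0..1}. f (\<gamma> s)) - (INF s\<in>{0..1}. f (\<gamma> s))"

definition height_dist :: "'a topology \<Rightarrow> ('a \<Rightarrow> real) \<Rightarrow> 'a \<Rightarrow> 'a \<Rightarrow> ennreal" where
  "height_dist X f u v =
     (INF \<gamma>\<in>{\<gamma>. pathin X \<gamma> \<and> \<gamma> 0 = u \<and> \<gamma> 1 = v}. ennreal (path_height f \<gamma>))"

text \<open>The absolute difference of extended nonnegative numbers, with \<open>\<bar>\<infinity> - \<infinity>\<bar> = 0\<close>. The case
  distinction is needed since \<open>\<infinity> - \<infinity> = \<infinity>\<close> for \<^typ>\<open>ennreal\<close>; the truncated difference in the
  wrong direction is \<open>0\<close>.\<close>

definition ennreal_absdiff :: "ennreal \<Rightarrow> ennreal \<Rightarrow> ennreal" where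
  "ennreal_absdiff a b = (if a = b then 0 else max (a - b) (b - a))"

definition correspondence ::
  "'a topology \<Rightarrow> 'b topology \<Rightarrow> ('a \<Rightarrow> 'b) \<Rightarrow> ('b \<Rightarrow> 'a) \<Rightarrow> ('a \<times> 'b) set" where
  "correspondence X Y \<phi> \<psi> = {(x, y) \<in> topspace X \<times> topspace Y. \<phi> x = y \<or> x = \<psi> y}"

definition distortion ::
  "'a topology \<Rightarrow> ('a \<Rightarrow> real) \<Rightarrow> 'b topology \<Rightarrow> ('b \<Rightarrow> real) \<Rightarrow>
   ('a \<Rightarrow> 'b) \<Rightarrow> ('b \<Rightarrow> 'a) \<Rightarrow> ennreal" where
  "distortion X f Y g \<phi> \<psi> =
     (SUP (x, y)\<in>correspondence X Y \<phi> \<psi>. SUP (x', y')\<in>correspondence X Y \<phi> \<psi>.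
        ennreal_absdiff (height_dist X f x x') (height_dist Y g y y') / 2)"

definition sup_dist :: "'a topology \<Rightarrow> ('a \<Rightarrow> real) \<Rightarrow> ('a \<Rightarrow> real) \<Rightarrow> ennreal" where
  "sup_dist X f h = (SUP x\<in>topspace X. ennreal \<bar>f x - h x\<bar>)"

definition functional_distortion_dist ::
  "'a topology \<Rightarrow> ('a \<Rightarrow> real) \<Rightarrow> 'b topology \<Rightarrow> ('b \<Rightarrow> real) \<Rightarrow> ennreal" where
  "functional_distortion_dist X f Y g =
     (INF (\<phi>, \<psi>)\<in>{(\<phi>, \<psi>). continuous_map X Y \<phi> \<and> continuous_map Y X \<psi>}.
        max (distortion X f Y g \<phi> \<psi>) (max (sup_dist X f (g \<circ> \<phi>)) (sup_dist Y g (f \<circ> \<psi>))))"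


section \<open>Strong equivalence\<close>

definition strongly_equivalent_on ::
  "'a set \<Rightarrow> ('a \<Rightarrow> 'a \<Rightarrow> ennreal) \<Rightarrow> ('a \<Rightarrow> 'a \<Rightarrow> ennreal) \<Rightarrow> bool" where
  "strongly_equivalent_on S d d' \<longleftrightarrow>
     (\<exists>\<alpha> \<beta> :: real. 0 < \<alpha> \<and> 0 < \<beta> \<and>
        (\<forall>p\<in>S. \<forall>q\<in>S. ennreal \<alpha> * d p q \<le> d' p q \<and> d' p q \<le> ennreal \<beta> * d p q))"

end

theory Submission
  imports Defs
begin

text \<open>Maps \<open>\<phi>\<close>, \<open>\<psi>\<close> of distortion below \<open>\<epsilon>\<close> yield the interleaving \<open>x \<mapsto> [\<phi> x, f x - g (\<phi> x)]\<close>: a path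
  of height at most \<open>2\<epsilon>\<close> from \<open>x\<close> to \<open>\<psi> (\<phi> x)\<close> lifts to a level set of the twice smoothed space by
  splitting its height defect evenly between the two smoothing coordinates.

  Conversely, the quotient map from \<open>Y \<times> [-\<epsilon>, \<epsilon>]\<close> to the smoothing has path-connected fibres and
  locally path-connected domain, so every map from a finite graph to the smoothing lifts, edge by
  edge and up to an arbitrarily small height error \<open>\<delta>\<close>, to \<open>Y \<times> [-\<epsilon>, \<epsilon>]\<close>. Projecting the lifts of an
  \<open>\<epsilon>\<close>-interleaving to \<open>Y\<close> and \<open>X\<close> moves heights by at most \<open>r = \<epsilon> + \<delta>\<close>, and the commutativity
  conditions connect \<open>x\<close> to \<open>\<psi> (\<phi> x)\<close> at heights within \<open>2r\<close> of \<open>f x\<close>. Transporting paths by \<open>\<phi>\<close> and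
  \<open>\<psi>\<close> then bounds the distortion by \<open>3r\<close>, so that even the constant 3 is obtained.\<close>

section \<open>Lifting along quotient maps with path-connected fibres\<close>

lemma path_component_of_subtopology_mono:
  assumes "path_component_of (subtopology X S) x y" "\<And>z. z \<in> topspace X \<Longrightarrow> z \<in> S \<Longrightarrow> z \<in> T"
  shows "path_component_of (subtopology X T) x y"
proof -
  have "path_component_of (subtopology X (topspace X \<inter> S)) x y"
    using assms(1) by (metis subtopology_restrict)
  moreover have "topspace X \<inter> S \<subseteq> T"
    using assms(2) by blast
  ultimately show ?thesis
    by (rule path_component_of_mono)
qed

lemma path_component_of_subtopology_image:
  assumes "path_component_of (subtopology X S) x y" "continuous_map X Y \<phi>"
    "\<And>x. x \<in> topspace X \<Longrightarrow> x \<in> S \<Longrightarrow> \<phi> x \<in> T"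
  shows "path_component_of (subtopology Y T) (\<phi> x) (\<phi> y)"
proof (rule path_component_of_continuous_image[OF _ assms(1)])
  show "continuous_map (subtopology X S) (subtopology Y T) \<phi>"
    using assms(2,3) by (auto simp: continuous_map_in_subtopology continuous_map_from_subtopology)
qed

lemma path_component_of_subtopology_path:
  assumes "pathin X \<gamma>" "\<And>t. t \<in> {0..1} \<Longrightarrow> \<gamma> t \<in> S" "s \<in> {0..1}" "t \<in> {0..1}"
  shows "path_component_of (subtopology X S) (\<gamma> s) (\<gamma> t)"
proof -
  have "pathin (subtopology X S) \<gamma>"
    using assms by (auto simp: pathin_subtopology)
  then have "path_connectedin (subtopology X S) (\<gamma> ` {0..1})"
    by (rule path_connectedin_path_image)
  then show ?thesis
    using assms(3,4) by (auto simp: path_component_of)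
qed

lemma path_component_of_subtopologyE:
  assumes "path_component_of (subtopology X S) x y"
  obtains \<gamma> where "pathin X \<gamma>" "\<gamma> 0 = x" "\<gamma> 1 = y" "\<forall>t\<in>{0..1}. \<gamma> t \<in> S"
  using assms unfolding path_component_of_def pathin_subtopology by auto

text \<open>The fibre itself is the path-connected set joining the two points. This keeps path
  components saturated, and it compares a chosen lift of a vertex with every other point above
  it.\<close>

lemma path_component_of_fibre:
  assumes "\<forall>z. path_connectedin P {r \<in> topspace P. q r = z}"
    and "p \<in> topspace P" "p' \<in> topspace P" "q p = q p'"
  shows "path_component_of (subtopology P {r. q r = q p}) p p'"
  unfolding path_component_of path_connectedin_subtopology
  using assms by (intro exI[of _ "{r \<in> topspace P. q r = q p}"]) auto

text \<open>Since the fibres are path connected, the path components of the open preimage of \<open>U\<close> are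
  saturated, so their images are disjoint open sets and the connected set \<open>C\<close> meets only one.\<close>

lemma path_component_of_lift:
  assumes P: "locally_path_connected_space P" and q: "quotient_map P Z q"
    and fibres: "\<forall>z. path_connectedin P {r \<in> topspace P. q r = z}"
    and U: "openin Z U" and C: "connectedin Z C" "C \<subseteq> U"
    and p: "p \<in> topspace P" "q p \<in> C" and p': "p' \<in> topspace P" "q p' \<in> C"
  shows "path_component_of (subtopology P {r. q r \<in> U}) p p'"
proof -
  define O' where "O' = {r \<in> topspace P. q r \<in> U}"
  have qc: "continuous_map P Z q"
    by (rule quotient_imp_continuous_map[OF q])
  have O': "openin P O'"
    unfolding O'_def by (rule openin_continuous_map_preimage[OF qc U])
  \<comment> \<open>Open subsets inherit local path connectedness, so the path component
    \<open>K\<close> is both open and closed in \<open>O'\<close>.\<close>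
  have lpc: "locally_path_connected_space (subtopology P O')"
    by (rule locally_path_connected_space_open_subset[OF P O'])
  have sub: "subtopology P O' = subtopology P {r. q r \<in> U}"
    unfolding O'_def by (metis subtopology_restrict Collect_conj_eq Collect_mem_eq)
  define K where "K = path_component_of_set (subtopology P O') p"
  have "openin (subtopology P O') K"
    unfolding K_def by (rule openin_path_component_of_locally_path_connected_space[OF lpc])
  then have K: "openin P K"
    using O' by (rule openin_trans_full)
  have "K \<subseteq> O'"
    unfolding K_def by (auto dest!: path_component_in_topspace)
  \<comment> \<open>A fibre meeting \<open>O'\<close> lies wholly in \<open>O'\<close> and is path
    connected, so it cannot be split between \<open>K\<close> and its complement.\<close>
  have sat: "r' \<in> K \<longleftrightarrow> r \<in> K" if "r \<in> O'" "r' \<in> O'" "q r = q r'" for r r'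
  proof -
    have "path_component_of (subtopology P O') r r'"
      by (rule path_component_of_subtopology_mono[OF path_component_of_fibre[OF fibres]]) (use that in \<open>auto simp: O'_def\<close>)
    then show ?thesis
      unfolding K_def by (metis mem_Collect_eq path_component_of_sym path_component_of_trans)
  qed
  \<comment> \<open>Saturation inside \<open>O'\<close> is saturation in all of \<open>P\<close>,
    because \<open>O'\<close> is itself a full preimage.\<close>
  have sat': "{r \<in> topspace P. q r \<in> q ` S} \<subseteq> S"
    if "S \<subseteq> O'" "\<And>r r'. r \<in> S \<Longrightarrow> r' \<in> O' \<Longrightarrow> q r = q r' \<Longrightarrow> r' \<in> S" for S
  proof clarsimp
    fix r r' assume r: "r' \<in> topspace P" "q r' = q r" "r \<in> S"
    then have "r \<in> O'" using that(1) by blast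
    then have "r' \<in> O'" using r by (simp add: O'_def)
    then show "r' \<in> S" using that(2) r by metis
  qed
  have "openin P (O' - K)"
  proof -
    have "closedin (subtopology P O') K"
      unfolding K_def by (rule closedin_path_component_of_locally_path_connected_space[OF lpc])
    then have "openin (subtopology P O') (O' - K)"
      using topspace_subtopology_subset[OF openin_subset[OF O']] by (simp add: closedin_def)
    then show ?thesis using O' by (rule openin_trans_full)
  qed
  moreover have "{r \<in> topspace P. q r \<in> q ` K} \<subseteq> K" "{r \<in> topspace P. q r \<in> q ` (O' - K)} \<subseteq> O' - K"
    by (rule sat'; use sat \<open>K \<subseteq> O'\<close> in blast)+
  ultimately have open2: "openin Z (q ` K)" "openin Z (q ` (O' - K))"
    using q K unfolding quotient_map_saturated_open by blast+
  have CsubO: "C \<subseteq> q ` O'"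
    using C connectedin_subset_topspace[OF C(1)] quotient_imp_surjective_map[OF q]
    by (fastforce simp: O'_def)
  have "p \<in> K"
    unfolding K_def using p C by (auto simp: path_component_of_refl O'_def)
  have disj: "q ` K \<inter> q ` (O' - K) = {}"
    using sat \<open>K \<subseteq> O'\<close> by blast
  have "p' \<in> K"
  proof (rule ccontr)
    assume "p' \<notin> K"
    moreover have "p' \<in> O'" using p' C by (auto simp: O'_def)
    ultimately show False
      using connectedinD[OF C(1) open2] CsubO disj p p' \<open>p \<in> K\<close> by blast
  qed
  then show ?thesis by (simp add: K_def sub)
qed

section \<open>Approximate lifts of paths\<close>

lemma continuous_map_cases_interval:
  fixes \<gamma>1 \<gamma>2 :: "real \<Rightarrow> 'a"
  assumes "continuous_map (top_of_set {a..b}) X \<gamma>1" "continuous_map (top_of_set {b..c}) X \<gamma>2"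
    "\<gamma>1 b = \<gamma>2 b" "a \<le> b" "b \<le> c"
  shows "continuous_map (top_of_set {a..c}) X (\<lambda>t. if t \<le> b then \<gamma>1 t else \<gamma>2 t)"
proof (rule continuous_map_cases_le)
  have "{x \<in> {a..c}. x \<le> b} = {a..b}" "{x \<in> {a..c}. b \<le> x} = {b..c}"
    "{a..c} \<inter> {a..b} = {a..b}" "{a..c} \<inter> {b..c} = {b..c}" using assms by auto
  with assms show "continuous_map (subtopology (top_of_set {a..c}) {x \<in> topspace (top_of_set {a..c}). x \<le> b}) X \<gamma>1"
      "continuous_map (subtopology (top_of_set {a..c}) {x \<in> topspace (top_of_set {a..c}). b \<le> x}) X \<gamma>2"
    by (simp_all add: subtopology_subtopology)
qed (use assms in auto)

text \<open>On a short time interval \<open>c\<close> stays in an open height band, over which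
  \<open>path_component_of_lift\<close> joins any two points lying above the path; such pieces are
  glued by bisection. The lift need not project to \<open>c\<close>: it is only required that
  \<open>\<gamma> t\<close> can be joined, near the height of \<open>c t\<close>, to every point
  above \<open>c t\<close>. Prescribed endpoints permit gluing at the vertices of a graph.\<close>

lemma approximate_path_lift:
  fixes h :: "'z \<Rightarrow> real"
  assumes P: "locally_path_connected_space P" and q: "quotient_map P Z q"
    and fibres: "\<forall>z. path_connectedin P {r \<in> topspace P. q r = z}"
    and h: "continuous_map Z euclideanreal h" and "\<delta> > 0"
    and c: "pathin Z c"
    and p: "p \<in> topspace P" "q p = c 0" and p': "p' \<in> topspace P" "q p' = c 1"
  shows "\<exists>\<gamma>. pathin P \<gamma> \<and> \<gamma> 0 = p \<and> \<gamma> 1 = p' \<and>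
    (\<forall>t\<in>{0..1}. \<forall>r\<in>topspace P. q r = c t \<longrightarrow>
       path_component_of (subtopology P {s. \<bar>h (q s) - h (c t)\<bar> < \<delta>}) (\<gamma> t) r)"
proof -
  define good where "good a b \<gamma> \<longleftrightarrow> continuous_map (top_of_set {a..b}) P \<gamma> \<and>
     (\<forall>t\<in>{a..b}. \<forall>r\<in>topspace P. q r = c t \<longrightarrow>
       path_component_of (subtopology P {s. \<bar>h (q s) - h (c t)\<bar> < \<delta>}) (\<gamma> t) r)" for a b \<gamma>
  \<comment> \<open>Quantifying over all endpoints lets two lifts be glued at any chosen point above
    \<open>c b\<close>. The premise \<open>a < b\<close> excludes the degenerate interval, where two
    different points of a fibre would be prescribed at one time.\<close>
  define Q where "Q a b \<longleftrightarrow> (0 \<le> a \<longrightarrow> b \<le> 1 \<longrightarrow> a < b \<longrightarrow>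
    (\<forall>p\<in>topspace P. \<forall>p'\<in>topspace P. q p = c a \<longrightarrow> q p' = c b \<longrightarrow>
       (\<exists>\<gamma>. good a b \<gamma> \<and> \<gamma> a = p \<and> \<gamma> b = p')))" for a b
  have surj: "q ` topspace P = topspace Z"
    by (rule quotient_imp_surjective_map[OF q])
  have cZ: "c t \<in> topspace Z" if "t \<in> {0..1}" for t
    using c that by (auto simp: pathin_def continuous_map_def)
  have hc: "continuous_on {0..1} (h \<circ> c)"
    using continuous_map_compose[OF c[unfolded pathin_def] h] by simp
  have "Q 0 1"
  proof (rule Bolzano)
    show "(0::real) \<le> 1" by simp
  next
    fix a b d :: real
    assume Q: "Q a b" "Q b d" and le: "a \<le> b" "b \<le> d"
    show "Q a d"
    proof (cases "a = b \<or> b = d")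
      case True
      then show ?thesis using Q by auto
    next
      case False
      with le have lt: "a < b" "b < d" by auto
      show ?thesis unfolding Q_def
      proof (intro impI ballI)
        fix p p' assume *: "0 \<le> a" "d \<le> 1" "p \<in> topspace P" "p' \<in> topspace P" "q p = c a" "q p' = c d"
        then have "c b \<in> topspace Z" using cZ[of b] lt by auto
        then obtain m where m: "m \<in> topspace P" "q m = c b" using surj by (metis imageE)
        obtain \<gamma>1 where \<gamma>1: "good a b \<gamma>1" "\<gamma>1 a = p" "\<gamma>1 b = m"
          using Q(1) * m lt unfolding Q_def by fastforce
        obtain \<gamma>2 where \<gamma>2: "good b d \<gamma>2" "\<gamma>2 b = m" "\<gamma>2 d = p'"
          using Q(2) * m lt unfolding Q_def by fastforce
        let ?\<gamma> = "\<lambda>t. if t \<le> b then \<gamma>1 t else \<gamma>2 t"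
        have "continuous_map (top_of_set {a..d}) P ?\<gamma>"
          using \<gamma>1 \<gamma>2 lt by (intro continuous_map_cases_interval) (auto simp: good_def)
        then have "good a d ?\<gamma>"
          using \<gamma>1(1) \<gamma>2(1) by (auto simp: good_def)
        then show "\<exists>\<gamma>. good a d \<gamma> \<and> \<gamma> a = p \<and> \<gamma> d = p'"
          using \<gamma>1 \<gamma>2 lt by (intro exI[of _ ?\<gamma>]) auto
      qed
    qed
  next
    fix x :: real assume x: "0 \<le> x" "x \<le> 1"
    \<comment> \<open>Radius \<open>\<delta> / 2\<close> around \<open>h (c x)\<close> makes any two
      heights in the band differ by less than \<open>\<delta>\<close>.\<close>
    then obtain d where d: "d > 0" "\<And>s. s \<in> {0..1} \<Longrightarrow> \<bar>s - x\<bar> < d \<Longrightarrow> \<bar>h (c s) - h (c x)\<bar> < \<delta> / 2"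
      using hc \<open>\<delta> > 0\<close> unfolding continuous_on_iff
      by (metis (no_types, opaque_lifting) atLeastAtMost_iff comp_apply dist_real_def half_gt_zero)
    have "Q a b" if ab: "a \<le> x" "x \<le> b" "b - a < d" for a b
      unfolding Q_def
    proof (intro impI ballI)
      fix p p' assume *: "0 \<le> a" "b \<le> 1" "a < b" "p \<in> topspace P" "p' \<in> topspace P" "q p = c a" "q p' = c b"
      define U where "U = {z \<in> topspace Z. h z \<in> {h (c x) - \<delta>/2 <..< h (c x) + \<delta>/2}}"
      define C where "C = c ` {a..b}"
      have U: "openin Z U"
        unfolding U_def by (rule openin_continuous_map_preimage[OF h]) simp
      have cab: "continuous_map (top_of_set {a..b}) Z c"
        using continuous_map_from_subtopology_mono[of euclideanreal "{0..1}" Z c "{a..b}"] c *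
        by (auto simp: pathin_def)
      have C: "connectedin Z C"
        unfolding C_def
        by (rule connectedin_continuous_map_image[OF cab]) (simp add: connectedin_subtopology)
      have CU: "C \<subseteq> U"
      proof -
        have "c t \<in> U" if "t \<in> {a..b}" for t
        proof -
          have "\<bar>h (c t) - h (c x)\<bar> < \<delta> / 2"
            using that * ab by (intro d(2)) auto
          then have "h (c t) \<in> {h (c x) - \<delta>/2 <..< h (c x) + \<delta>/2}"
            unfolding greaterThanLessThan_iff by linarith
          moreover have "c t \<in> topspace Z"
            using that * by (intro cZ) auto
          ultimately show ?thesis
            by (simp add: U_def)
        qed
        then show ?thesis by (auto simp: C_def)
      qed
      have joined: "path_component_of (subtopology P {r. q r \<in> U}) r r'"
        if "r \<in> topspace P" "q r \<in> C" "r' \<in> topspace P" "q r' \<in> C" for r r'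
        by (rule path_component_of_lift[OF P q fibres U C CU that])
      have "c a \<in> C" "c b \<in> C" using * by (auto simp: C_def)
      with * have "path_component_of (subtopology P {r. q r \<in> U}) p p'"
        by (intro joined) simp_all
      then obtain g where g: "pathin P g" "g 0 = p" "g 1 = p'" "\<forall>t\<in>{0..1}. g t \<in> {r. q r \<in> U}"
        by (rule path_component_of_subtopologyE)
      \<comment> \<open>The path \<open>g\<close> is an arbitrary connection over the band
        \<open>U\<close>; only its heights are controlled, so it may be reparametrised
        linearly.\<close>
      define \<gamma> where "\<gamma> = g \<circ> (\<lambda>t. (t - a) / (b - a))"
      have "continuous_map (top_of_set {a..b}) (top_of_set {0..1}) (\<lambda>t. (t - a) / (b - a))"
        using * by (auto simp: continuous_map_in_subtopology divide_simps intro!: continuous_intros)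
      then have "continuous_map (top_of_set {a..b}) P \<gamma>"
        unfolding \<gamma>_def using g(1) unfolding pathin_def by (rule continuous_map_compose)
      moreover have "path_component_of (subtopology P {s. \<bar>h (q s) - h (c t)\<bar> < \<delta>}) (\<gamma> t) r"
        if "t \<in> {a..b}" "r \<in> topspace P" "q r = c t" for t r
      proof -
        let ?t = "(t - a) / (b - a)"
        have "?t \<in> {0..1}" using that * by (simp add: divide_simps)
        then have "path_component_of (subtopology P {r. q r \<in> U}) (g 0) (g ?t)"
          using g(1,4) by (intro path_component_of_subtopology_path) auto
        \<comment> \<open>The starting point \<open>p\<close> serves as a hub:
          \<open>\<gamma> t\<close> reaches it along \<open>g\<close>, and every \<open>r\<close>
          above \<open>c t\<close> reaches it by the lifting lemma.\<close>
        moreover have "path_component_of (subtopology P {r. q r \<in> U}) p r"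
          using that * \<open>c a \<in> C\<close> by (intro joined) (auto simp: C_def)
        ultimately have "path_component_of (subtopology P {r. q r \<in> U}) (\<gamma> t) r"
          by (metis \<gamma>_def comp_apply g(2) path_component_of_sym path_component_of_trans)
        moreover have "h (c t) \<in> {h (c x) - \<delta>/2 <..< h (c x) + \<delta>/2}"
          using CU that unfolding C_def U_def by blast
        ultimately show ?thesis
          by (elim path_component_of_subtopology_mono) (auto simp: U_def)
      qed
      ultimately have "good a b \<gamma>" by (auto simp: good_def)
      moreover have "\<gamma> a = p" "\<gamma> b = p'" using g * by (auto simp: \<gamma>_def)
      ultimately show "\<exists>\<gamma>. good a b \<gamma> \<and> \<gamma> a = p \<and> \<gamma> b = p'" by blast
    qed
    then show "\<exists>d>0. \<forall>a b. a \<le> x \<and> x \<le> b \<and> b - a < d \<longrightarrow> Q a b"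
      using d(1) by blast
  qed
  then obtain \<gamma> where "good 0 1 \<gamma>" "\<gamma> 0 = p" "\<gamma> 1 = p'"
    using p p' unfolding Q_def by fastforce
  then show ?thesis
    unfolding good_def pathin_def by blast
qed

text \<open>Clamping retracts the real line onto a nonempty interval; the empty case is
  vacuous.\<close>

lemma locally_path_connected_space_interval:
  "locally_path_connected_space (top_of_set {a..b::real})"
proof (cases "a \<le> b")
  case True
  have "continuous_on UNIV (\<lambda>t. max a (min b t))"
    by (intro continuous_intros)
  then have "retraction_maps euclideanreal (top_of_set {a..b}) (\<lambda>t. max a (min b t)) id"
    using True unfolding retraction_maps_def continuous_map_in_subtopology by auto
  then show ?thesis
    using locally_path_connected_space_retraction_map_image locally_path_connected_space_euclideanreal
    unfolding retraction_map_def by blast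
next
  case False
  then show ?thesis
    by (simp add: locally_path_connected_space_def neighbourhood_base_of)
qed


section \<open>Finite graphs\<close>

lemma embedding_imp_continuous_map: "embedding_map X Y f \<Longrightarrow> continuous_map X Y f"
  unfolding embedding_map_def using homeomorphic_imp_continuous_map continuous_map_in_subtopology
  by blast

lemma continuous_map_from_sum_topology:
  assumes "\<And>i. i \<in> I \<Longrightarrow> continuous_map (X i) Y (\<lambda>x. f (i, x))"
  shows "continuous_map (sum_topology X I) Y f"
  unfolding continuous_map
proof (intro conjI allI impI)
  show "f ` topspace (sum_topology X I) \<subseteq> topspace Y"
    using assms by (fastforce simp: continuous_map)
next
  fix U assume U: "openin Y U"
  have "openin (X i) {x. (i, x) \<in> {p \<in> topspace (sum_topology X I). f p \<in> U}}" if "i \<in> I" for i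
    using openin_continuous_map_preimage[OF assms[OF that] U] that by simp
  then show "openin (sum_topology X I) {p \<in> topspace (sum_topology X I). f p \<in> U}"
    unfolding openin_sum_topology by auto
qed

text \<open>The 0-cells are presented as constant maps, so that every cell is an image of the unit
  interval.\<close>

definition graph_cells :: "'a set \<Rightarrow> (real \<Rightarrow> 'a) set \<Rightarrow> (real \<Rightarrow> 'a) set" where
  "graph_cells V E = E \<union> (\<lambda>v _. v) ` V"

text \<open>Each cell is a continuous map from a compact space to a Hausdorff space, hence closed,
  and a finite union of closed images is closed. Continuity on a graph can therefore be tested cell
  by cell.\<close>

lemma quotient_map_graph_cells:
  assumes "finite_graph X V E"
  shows "quotient_map (sum_topology (\<lambda>_. top_of_set {0..1}) (graph_cells V E)) X (\<lambda>(e, t). e t)"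
    (is "quotient_map ?S X ?q")
proof (rule continuous_closed_imp_quotient_map)
  have cont: "continuous_map (top_of_set {0..1}) X e" if "e \<in> graph_cells V E" for e
    using that assms unfolding graph_cells_def finite_graph_def
    by (auto dest: embedding_imp_continuous_map)
  show "continuous_map ?S X ?q"
    by (rule continuous_map_from_sum_topology) (simp add: cont)
  show "closed_map ?S X ?q"
    unfolding closed_map_def
  proof (intro allI impI)
    fix C assume C: "closedin ?S C"
    have "closedin X (e ` {t. (e, t) \<in> C})" if e: "e \<in> graph_cells V E" for e
    proof -
      have "closed_map (top_of_set {0..1}) X e"
        using cont[OF e] assms unfolding finite_graph_def
        by (intro continuous_imp_closed_map) (auto simp: compact_space_subtopology)
      then show ?thesis
        using C e unfolding closed_map_def closedin_sum_topology by blast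
    qed
    moreover have "finite (graph_cells V E)"
      using assms by (simp add: graph_cells_def finite_graph_def)
    ultimately have "closedin X (\<Union>e\<in>graph_cells V E. e ` {t. (e, t) \<in> C})"
      by (intro closedin_Union) auto
    moreover have "?q ` C = (\<Union>e\<in>graph_cells V E. e ` {t. (e, t) \<in> C})"
      using closedin_subset[OF C] by force
    ultimately show "closedin X (?q ` C)" by simp
  qed
  show "?q ` topspace ?S = topspace X"
  proof -
    have "?q ` topspace ?S = (\<Union>e\<in>graph_cells V E. e ` {0..1})"
      by force
    also have "\<dots> = V \<union> (\<Union>e\<in>E. e ` {0..1})"
      by (simp add: graph_cells_def Un_commute image_constant_conv)
    finally show ?thesis
      using assms by (simp add: finite_graph_def)
  qed
qed

lemma locally_path_connected_space_graph:
  assumes "finite_graph X V E"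
  shows "locally_path_connected_space X"
  by (rule locally_path_connected_space_quotient_map_image[OF quotient_map_graph_cells[OF assms]])
    (simp add: locally_path_connected_space_sum_topology locally_path_connected_space_interval)

text \<open>Lifts of the vertices are fixed first, and each edge is then lifted with these
  endpoints. The edge lifts agree at the vertices and so descend to a continuous map on the
  graph.\<close>

lemma approximate_graph_lift:
  fixes h :: "'z \<Rightarrow> real"
  assumes X: "finite_graph X V E"
    and P: "locally_path_connected_space P" and q: "quotient_map P Z q"
    and fibres: "\<forall>z. path_connectedin P {r \<in> topspace P. q r = z}"
    and h: "continuous_map Z euclideanreal h" and "\<delta> > 0"
    and \<Phi>: "continuous_map X Z \<Phi>"
  obtains F where "continuous_map X P F"
    "\<And>x r. \<lbrakk>x \<in> topspace X; r \<in> topspace P; q r = \<Phi> x\<rbrakk> \<Longrightarrow>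
       path_component_of (subtopology P {s. \<bar>h (q s) - h (\<Phi> x)\<bar> < \<delta>}) (F x) r"
proof -
  have emb: "embedding_map (top_of_set {0..1}) X e" and ends: "e 0 \<in> V" "e 1 \<in> V"
    and inner: "e ` {0<..<1} \<inter> V = {}" if "e \<in> E" for e
    using X that by (auto simp: finite_graph_def)
  have disj: "e ` {0<..<1} \<inter> e' ` {0<..<1} = {}" if "e \<in> E" "e' \<in> E" "e \<noteq> e'" for e e'
    using X that by (auto simp: finite_graph_def)
  have V: "V \<subseteq> topspace X" and top: "topspace X = V \<union> (\<Union>e\<in>E. e ` {0..1})"
    using X by (auto simp: finite_graph_def)
  define close where "close x p \<longleftrightarrow> (\<forall>r\<in>topspace P. q r = \<Phi> x \<longrightarrow>
       path_component_of (subtopology P {s. \<bar>h (q s) - h (\<Phi> x)\<bar> < \<delta>}) p r)" for x p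
  define L where "L v = inv_into (topspace P) q (\<Phi> v)" for v
  have im: "\<Phi> v \<in> q ` topspace P" if "v \<in> V" for v
    unfolding quotient_imp_surjective_map[OF q]
    by (rule subsetD[OF continuous_map_image_subset_topspace[OF \<Phi>] imageI[OF subsetD[OF V that]]])
  have L: "L v \<in> topspace P" "q (L v) = \<Phi> v" if "v \<in> V" for v
    unfolding L_def by (rule inv_into_into[OF im[OF that]], rule f_inv_into_f[OF im[OF that]])
  \<comment> \<open>At a vertex the lift is exact, so path connectedness of the fibre alone gives
    the required connection.\<close>
  have close_L: "close v (L v)" if "v \<in> V" for v
    unfolding close_def
  proof (intro ballI impI)
    fix r assume r: "r \<in> topspace P" "q r = \<Phi> v"
    then have "path_component_of (subtopology P {s. q s = q (L v)}) (L v) r"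
      using L[OF that] by (intro path_component_of_fibre[OF fibres]) simp_all
    then show "path_component_of (subtopology P {s. \<bar>h (q s) - h (\<Phi> v)\<bar> < \<delta>}) (L v) r"
      by (rule path_component_of_subtopology_mono) (use L[OF that] \<open>\<delta> > 0\<close> in simp)
  qed
  have "\<exists>\<gamma>. pathin P \<gamma> \<and> \<gamma> 0 = L (e 0) \<and> \<gamma> 1 = L (e 1) \<and> (\<forall>t\<in>{0..1}. close (e t) (\<gamma> t))"
    if e: "e \<in> E" for e
  proof -
    have "pathin Z (\<Phi> \<circ> e)"
      unfolding pathin_def
      by (rule continuous_map_compose[OF embedding_imp_continuous_map[OF emb[OF e]] \<Phi>])
    then have "\<exists>\<gamma>. pathin P \<gamma> \<and> \<gamma> 0 = L (e 0) \<and> \<gamma> 1 = L (e 1) \<and>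
      (\<forall>t\<in>{0..1}. \<forall>r\<in>topspace P. q r = (\<Phi> \<circ> e) t \<longrightarrow>
         path_component_of (subtopology P {s. \<bar>h (q s) - h ((\<Phi> \<circ> e) t)\<bar> < \<delta>}) (\<gamma> t) r)"
      by (rule approximate_path_lift[OF P q fibres h \<open>\<delta> > 0\<close>]) (simp_all add: L ends[OF e])
    then show ?thesis by (simp add: close_def)
  qed
  then obtain \<gamma> where \<gamma>: "\<And>e. e \<in> E \<Longrightarrow> pathin P (\<gamma> e) \<and> \<gamma> e 0 = L (e 0) \<and> \<gamma> e 1 = L (e 1) \<and>
      (\<forall>t\<in>{0..1}. close (e t) (\<gamma> e t))"
    by metis
  \<comment> \<open>Off the vertices the choice is unique: open edges are disjoint and every
    characteristic map is injective.\<close>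
  define F where "F x = (if x \<in> V then L x else
      (SOME p. \<exists>e\<in>E. \<exists>t\<in>{0<..<1}. x = e t \<and> p = \<gamma> e t))" for x
  have F_edge: "F (e t) = \<gamma> e t" if e: "e \<in> E" and t: "t \<in> {0..1}" for e t
  proof (cases "t = 0 \<or> t = 1")
    case True
    then show ?thesis using ends[OF e] \<gamma>[OF e] by (auto simp: F_def)
  next
    case False
    with t have t': "t \<in> {0<..<1}" by auto
    then have "e t \<notin> V" using inner[OF e] by blast
    moreover have "p = \<gamma> e t" if "e' \<in> E" "s \<in> {0<..<1}" "e t = e' s" "p = \<gamma> e' s" for e' s p
    proof -
      have "e' = e" using disj[OF e that(1)] t' that by blast
      moreover have "inj_on e {0..1}"
        using homeomorphic_imp_injective_map[OF emb[OF e, unfolded embedding_map_def]] by simp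
      ultimately have "t = s"
        using that t by (auto dest!: inj_onD)
      with \<open>e' = e\<close> show ?thesis using that by simp
    qed
    moreover have "\<exists>e'\<in>E. \<exists>s\<in>{0<..<1}. e t = e' s \<and> \<gamma> e t = \<gamma> e' s"
      using e t' by blast
    ultimately have "(SOME p. \<exists>e'\<in>E. \<exists>s\<in>{0<..<1}. e t = e' s \<and> p = \<gamma> e' s) = \<gamma> e t"
      by (intro some_equality) metis+
    with \<open>e t \<notin> V\<close> show ?thesis by (simp add: F_def)
  qed
  show thesis
  proof
    have "continuous_map (sum_topology (\<lambda>_. top_of_set {0..1}) (graph_cells V E)) P (F \<circ> (\<lambda>(e, t). e t))"
    proof (rule continuous_map_from_sum_topology)
      fix e assume "e \<in> graph_cells V E"
      then consider "e \<in> E" | v where "v \<in> V" "e = (\<lambda>_. v)"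
        by (auto simp: graph_cells_def)
      then show "continuous_map (top_of_set {0..1}) P (\<lambda>t. (F \<circ> (\<lambda>(e, t). e t)) (e, t))"
      proof cases
        case 1
        then show ?thesis
          using \<gamma>[OF 1] F_edge[OF 1] unfolding pathin_def
          by (auto intro: continuous_map_eq[of _ _ "\<gamma> e"])
      next
        case 2
        then show ?thesis using L by (simp add: F_def)
      qed
    qed
    then show "continuous_map X P F"
      by (rule continuous_compose_quotient_map[OF quotient_map_graph_cells[OF X]])
  next
    fix x r assume *: "x \<in> topspace X" "r \<in> topspace P" "q r = \<Phi> x"
    have "close x (F x)"
    proof (cases "x \<in> V")
      case True
      then show ?thesis using close_L by (simp add: F_def)
    next
      case False
      with * top obtain e t where "e \<in> E" "t \<in> {0..1}" "x = e t" by auto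
      then show ?thesis using \<gamma> F_edge by metis
    qed
    then show "path_component_of (subtopology P {s. \<bar>h (q s) - h (\<Phi> x)\<bar> < \<delta>}) (F x) r"
      using * by (simp add: close_def)
  qed
qed


section \<open>Height bands and smoothings\<close>

text \<open>Explicit bounds \<open>a\<close> and \<open>b\<close> replace the height of a path:
  bands can be widened, shifted by a map and concatenated, while the height itself only records
  their width.\<close>

definition joined :: "'a topology \<Rightarrow> ('a \<Rightarrow> real) \<Rightarrow> real \<Rightarrow> real \<Rightarrow> 'a \<Rightarrow> 'a \<Rightarrow> bool" where
  "joined X f a b u v \<longleftrightarrow> path_component_of (subtopology X {x. a \<le> f x \<and> f x \<le> b}) u v"

lemma joined_in:
  assumes "joined X f a b u v"
  shows "u \<in> topspace X" "v \<in> topspace X" "a \<le> f u" "f u \<le> b" "a \<le> f v" "f v \<le> b"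
  using path_component_in_topspace[OF assms[unfolded joined_def]] by auto

lemma joined_refl: "u \<in> topspace X \<Longrightarrow> a \<le> f u \<Longrightarrow> f u \<le> b \<Longrightarrow> joined X f a b u u"
  by (simp add: joined_def path_component_of_refl)

lemma joined_sym: "joined X f a b u v \<Longrightarrow> joined X f a b v u"
  by (simp add: joined_def path_component_of_sym)

lemma joined_trans: "joined X f a b u v \<Longrightarrow> joined X f a b v w \<Longrightarrow> joined X f a b u w"
  unfolding joined_def by (rule path_component_of_trans)

lemma joined_mono:
  assumes "joined X f a b u v" "a' \<le> a" "b \<le> b'"
  shows "joined X f a' b' u v"
  using assms(1) unfolding joined_def
  by (rule path_component_of_subtopology_mono) (use assms(2,3) in auto)

lemma joined_image:
  assumes "joined X f a b u v" "continuous_map X Y \<phi>"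
    and r: "\<And>x. x \<in> topspace X \<Longrightarrow> \<bar>g (\<phi> x) - f x\<bar> \<le> r"
  shows "joined Y g (a - r) (b + r) (\<phi> u) (\<phi> v)"
  using assms(1,2) unfolding joined_def
proof (rule path_component_of_subtopology_image)
  fix x assume "x \<in> topspace X" "x \<in> {x. a \<le> f x \<and> f x \<le> b}"
  then show "\<phi> x \<in> {y. a - r \<le> g y \<and> g y \<le> b + r}"
    using r[of x] by auto
qed

lemma height_dist_le:
  assumes "joined X f a b u v"
  shows "height_dist X f u v \<le> ennreal (b - a)"
proof -
  obtain \<gamma> where \<gamma>: "pathin X \<gamma>" "\<gamma> 0 = u" "\<gamma> 1 = v" "\<forall>t\<in>{0..1}. \<gamma> t \<in> {x. a \<le> f x \<and> f x \<le> b}"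
    using path_component_of_subtopologyE[OF assms[unfolded joined_def]] .
  have "(SUP s\<in>{0..1}. f (\<gamma> s)) \<le> b" "a \<le> (INF s\<in>{0..1}. f (\<gamma> s))"
    using \<gamma>(4) by (auto intro!: cSUP_least cINF_greatest)
  then have "path_height f \<gamma> \<le> b - a"
    by (simp add: path_height_def)
  then show ?thesis
    unfolding height_dist_def using \<gamma> by (intro INF_lower2[of \<gamma>]) (auto intro: ennreal_leI)
qed

text \<open>The band runs from the infimum to the supremum of the heights; these bound the values
  because the continuous image of the compact unit interval is bounded.\<close>

lemma joined_path_height:
  assumes "pathin X \<gamma>" "continuous_map X euclideanreal f"
  obtains a b where "joined X f a b (\<gamma> 0) (\<gamma> 1)" "path_height f \<gamma> = b - a"
proof -
  have "continuous_on {0..1} (f \<circ> \<gamma>)"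
    using continuous_map_compose[OF assms(1)[unfolded pathin_def] assms(2)] by simp
  then have "compact ((f \<circ> \<gamma>) ` {0..1})"
    by (rule compact_continuous_image) simp
  then have "bounded ((\<lambda>s. f (\<gamma> s)) ` {0..1})"
    by (auto simp: o_def dest: compact_imp_bounded)
  then have bdd: "bdd_above ((\<lambda>s. f (\<gamma> s)) ` {0..1})" "bdd_below ((\<lambda>s. f (\<gamma> s)) ` {0..1})"
    by (rule bounded_imp_bdd_above, rule bounded_imp_bdd_below)
  let ?a = "INF s\<in>{0..1}. f (\<gamma> s)" and ?b = "SUP s\<in>{0..1}. f (\<gamma> s)"
  have "joined X f ?a ?b (\<gamma> 0) (\<gamma> 1)"
    unfolding joined_def
    by (rule path_component_of_subtopology_path[OF assms(1)])
      (use bdd in \<open>auto intro: cINF_lower cSUP_upper\<close>)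
  then show thesis
    by (rule that) (simp add: path_height_def)
qed

text \<open>The strict inequality selects a path below the bound, whether or not the infimum is
  attained.\<close>

lemma height_dist_less_joined:
  assumes "height_dist X f u v < ennreal c" "continuous_map X euclideanreal f"
  obtains a b where "joined X f a b u v" "b - a < c"
proof -
  obtain \<gamma> where \<gamma>: "pathin X \<gamma>" "\<gamma> 0 = u" "\<gamma> 1 = v" "ennreal (path_height f \<gamma>) < ennreal c"
    using assms(1) unfolding height_dist_def INF_less_iff by blast
  then have "path_height f \<gamma> < c"
    by (meson ennreal_leI not_le)
  then show thesis
    using joined_path_height[OF \<gamma>(1) assms(2)] \<gamma> that by metis
qed

lemma height_dist_refl: "x \<in> topspace X \<Longrightarrow> height_dist X f x x = 0"
  using height_dist_le[OF joined_refl, of x X "f x" f "f x"] by simp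

text \<open>Widening a band by \<open>r\<close> at both ends adds \<open>2 * r\<close> to its width.
  If \<open>y\<close> and \<open>y'\<close> are not connected, the right-hand side is
  infinite.\<close>

lemma height_dist_perturb:
  assumes "continuous_map Y euclideanreal g" "r \<ge> 0"
    and "\<And>a b. joined Y g a b y y' \<Longrightarrow> joined X f (a - r) (b + r) x x'"
  shows "height_dist X f x x' \<le> height_dist Y g y y' + ennreal (2 * r)"
proof -
  have "height_dist X f x x' \<le> ennreal (path_height g \<gamma>) + ennreal (2 * r)"
    if \<gamma>: "pathin Y \<gamma>" "\<gamma> 0 = y" "\<gamma> 1 = y'" for \<gamma>
  proof -
    obtain a b where ab: "joined Y g a b y y'" "path_height g \<gamma> = b - a"
      using joined_path_height[OF \<gamma>(1) assms(1)] \<gamma> by metis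
    have "height_dist X f x x' \<le> ennreal ((b + r) - (a - r))"
      by (rule height_dist_le[OF assms(3)[OF ab(1)]])
    also have "\<dots> = ennreal (path_height g \<gamma>) + ennreal (2 * r)"
      using joined_in[OF ab(1)] \<open>r \<ge> 0\<close> by (subst ennreal_plus[symmetric]) (auto simp: ab(2))
    finally show ?thesis .
  qed
  \<comment> \<open>The finite term is subtracted on the left so that the bound for each path passes
    to the infimum.\<close>
  then have "height_dist X f x x' - ennreal (2 * r) \<le> height_dist Y g y y'"
    unfolding height_dist_def[of Y]
    by (intro INF_greatest) (simp add: ennreal_minus_le_iff add.commute)
  then show ?thesis
    by (simp add: ennreal_minus_le_iff add.commute)
qed

section \<open>Reeb classes and smoothings as quotients\<close>

text \<open>A nonempty fibre of the class map is a Reeb class, that is, a path component of a level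
  set. This makes the lifting results applicable to smoothings.\<close>

lemma path_connectedin_reeb_class_fibre:
  "path_connectedin X {r \<in> topspace X. reeb_class X f r = z}"
proof (cases "\<exists>p\<in>topspace X. reeb_class X f p = z")
  case True
  then obtain p where p: "p \<in> topspace X" "reeb_class X f p = z" by blast
  have "{r \<in> topspace X. reeb_class X f r = z} = reeb_class X f p"
    using p reeb_class_self[of _ X f] reeb_classD[of _ X f p] by blast
  moreover have "path_connectedin X (reeb_class X f p)"
    unfolding reeb_class_def
    using path_connectedin_path_component_of path_connectedin_subtopology by metis
  ultimately show ?thesis by simp
next
  case False
  then have "{r \<in> topspace X. reeb_class X f r = z} = {}"
    by blast
  then show ?thesis by (simp only: path_connectedin_empty)
qed

lemma reeb_class_eqI:
  "path_component_of (subtopology X (level_set X f (f u))) u v \<Longrightarrow> reeb_class X f v = reeb_class X f u"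
  by (rule reeb_classD) (simp add: reeb_class_def)

lemma continuous_map_reeb_fun:
  assumes "continuous_map X euclideanreal f"
  shows "continuous_map (reeb_space X f) euclideanreal (reeb_fun f)"
proof (rule continuous_compose_quotient_map[OF quotient_map_reeb_class])
  show "continuous_map X euclideanreal (reeb_fun f \<circ> reeb_class X f)"
    using assms by (rule continuous_map_eq) (simp add: reeb_fun_class)
qed

lemma topspace_thickening: "topspace (thickening \<epsilon> X) = topspace X \<times> {-\<epsilon>..\<epsilon>}"
  by (simp add: thickening_def)

lemma continuous_map_thick_fun:
  assumes "continuous_map X euclideanreal f"
  shows "continuous_map (thickening \<epsilon> X) euclideanreal (thick_fun f)"
proof -
  have "continuous_map (thickening \<epsilon> X) euclideanreal (\<lambda>p. f (fst p))"
    "continuous_map (thickening \<epsilon> X) euclideanreal snd"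
    unfolding thickening_def
    using continuous_map_compose[OF continuous_map_fst assms] continuous_map_snd
    by (auto simp: o_def continuous_map_in_subtopology dest: continuous_map_into_fulltopology)
  then have "continuous_map (thickening \<epsilon> X) euclideanreal (\<lambda>p. f (fst p) + snd p)"
    by (rule continuous_map_add)
  then show ?thesis
    by (simp add: thick_fun_def case_prod_unfold)
qed

lemma quotient_map_smooth_class:
  "quotient_map (thickening \<epsilon> X) (smooth_space \<epsilon> X f) (smooth_class \<epsilon> X f)"
  unfolding smooth_space_def smooth_class_def by (rule quotient_map_reeb_class)

lemma smooth_fun_class:
  "x \<in> topspace X \<Longrightarrow> t \<in> {-\<epsilon>..\<epsilon>} \<Longrightarrow> smooth_fun f (smooth_class \<epsilon> X f (x, t)) = f x + t"
  by (simp add: smooth_fun_def smooth_class_def reeb_fun_class topspace_thickening thick_fun_def)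

lemma continuous_map_smooth_fun:
  "continuous_map X euclideanreal f \<Longrightarrow> continuous_map (smooth_space \<epsilon> X f) euclideanreal (smooth_fun f)"
  unfolding smooth_space_def smooth_fun_def
  by (intro continuous_map_reeb_fun continuous_map_thick_fun)

lemma smooth_classE:
  assumes "z \<in> topspace (smooth_space \<epsilon> X f)"
  obtains x t where "x \<in> topspace X" "t \<in> {-\<epsilon>..\<epsilon>}" "z = smooth_class \<epsilon> X f (x, t)"
  using assms that
  unfolding quotient_imp_surjective_map[OF quotient_map_smooth_class, symmetric] topspace_thickening
  by blast

lemma smooth_class_in_topspace:
  "x \<in> topspace X \<Longrightarrow> t \<in> {-\<epsilon>..\<epsilon>} \<Longrightarrow> smooth_class \<epsilon> X f (x, t) \<in> topspace (smooth_space \<epsilon> X f)"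
  using quotient_imp_surjective_map[OF quotient_map_smooth_class, of \<epsilon> X f]
  by (auto simp: topspace_thickening)

lemma path_connectedin_smooth_class_fibres:
  "\<forall>z. path_connectedin (thickening \<epsilon> X) {r \<in> topspace (thickening \<epsilon> X). smooth_class \<epsilon> X f r = z}"
  unfolding smooth_class_def by (simp add: path_connectedin_reeb_class_fibre)

lemma locally_path_connected_space_thickening:
  "locally_path_connected_space X \<Longrightarrow> locally_path_connected_space (thickening \<epsilon> X)"
  by (simp add: thickening_def locally_path_connected_space_prod_topology locally_path_connected_space_interval)

text \<open>Forgetting the smoothing coordinate changes heights by at most
  \<open>\<epsilon>\<close>.\<close>

lemma joined_thickening_fst:
  assumes "joined (thickening \<epsilon> X) (thick_fun f) a b (x, s) (y, t)"
  shows "joined X f (a - \<epsilon>) (b + \<epsilon>) x y"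
proof -
  have "continuous_map (thickening \<epsilon> X) X fst"
    by (simp add: thickening_def continuous_map_fst)
  moreover have "\<bar>f (fst p) - thick_fun f p\<bar> \<le> \<epsilon>" if "p \<in> topspace (thickening \<epsilon> X)" for p
    using that by (auto simp: topspace_thickening thick_fun_def)
  ultimately show ?thesis
    using joined_image[OF assms, of X fst f \<epsilon>] by simp
qed

text \<open>The closed band is enlarged by \<open>\<delta>\<close> to an open one, over which the
  connection lifts to the thickening; projecting to \<open>X\<close> costs a further
  \<open>\<epsilon>\<close>.\<close>

lemma joined_smooth_space_lift:
  assumes X: "locally_path_connected_space X" and f: "continuous_map X euclideanreal f"
    and j: "joined (smooth_space \<epsilon> X f) (smooth_fun f) a b
      (smooth_class \<epsilon> X f (x, s)) (smooth_class \<epsilon> X f (y, t))"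
    and "\<delta> > 0" and x: "x \<in> topspace X" "s \<in> {-\<epsilon>..\<epsilon>}" and y: "y \<in> topspace X" "t \<in> {-\<epsilon>..\<epsilon>}"
  shows "joined X f (a - (\<epsilon> + \<delta>)) (b + (\<epsilon> + \<delta>)) x y"
proof -
  let ?Z = "smooth_space \<epsilon> X f" and ?q = "smooth_class \<epsilon> X f" and ?h = "smooth_fun f"
  define U where "U = {z \<in> topspace ?Z. ?h z \<in> {a - \<delta><..<b + \<delta>}}"
  have U: "openin ?Z U"
    unfolding U_def
    by (rule openin_continuous_map_preimage[OF continuous_map_smooth_fun[OF f]]) simp
  obtain C where C: "path_connectedin (subtopology ?Z {z. a \<le> ?h z \<and> ?h z \<le> b}) C"
      "?q (x, s) \<in> C" "?q (y, t) \<in> C"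
    using j unfolding joined_def path_component_of by blast
  then have C': "connectedin ?Z C" "C \<subseteq> {z. a \<le> ?h z \<and> ?h z \<le> b}"
    by (auto simp: path_connectedin_subtopology path_connectedin_imp_connectedin)
  have "C \<subseteq> U"
    unfolding U_def using C'(2) connectedin_subset_topspace[OF C'(1)] \<open>\<delta> > 0\<close> by fastforce
  have "path_component_of (subtopology (thickening \<epsilon> X) {r. ?q r \<in> U}) (x, s) (y, t)"
    using path_component_of_lift[OF locally_path_connected_space_thickening[OF X]
      quotient_map_smooth_class path_connectedin_smooth_class_fibres U C'(1) \<open>C \<subseteq> U\<close>] C x y
    by (simp add: topspace_thickening)
  then have "joined (thickening \<epsilon> X) (thick_fun f) (a - \<delta>) (b + \<delta>) (x, s) (y, t)"
    unfolding joined_def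
  proof (rule path_component_of_subtopology_mono)
    fix p assume "p \<in> topspace (thickening \<epsilon> X)" "p \<in> {r. ?q r \<in> U}"
    then show "p \<in> {p. a - \<delta> \<le> thick_fun f p \<and> thick_fun f p \<le> b + \<delta>}"
      by (cases p) (auto simp: U_def topspace_thickening smooth_fun_class thick_fun_def)
  qed
  then show ?thesis
    by (rule joined_mono[OF joined_thickening_fst]) auto
qed


section \<open>From distortion to interleavings\<close>

text \<open>The smoothing coordinate compensates the height error of \<open>\<phi>\<close>, so that
  the class has height exactly \<open>f x\<close>.\<close>

definition shift_map ::
  "real \<Rightarrow> ('a \<Rightarrow> real) \<Rightarrow> 'b topology \<Rightarrow> ('b \<Rightarrow> real) \<Rightarrow> ('a \<Rightarrow> 'b) \<Rightarrow> 'a \<Rightarrow> ('b \<times> real) set" where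
  "shift_map \<epsilon> f Y g \<phi> x = smooth_class \<epsilon> Y g (\<phi> x, f x - g (\<phi> x))"

lemma continuous_map_smooth_class_pair:
  assumes "continuous_map Z Y \<phi>" "continuous_map Z euclideanreal \<tau>"
    "\<And>z. z \<in> topspace Z \<Longrightarrow> \<tau> z \<in> {-\<epsilon>..\<epsilon>}"
  shows "continuous_map Z (smooth_space \<epsilon> Y g) (\<lambda>z. smooth_class \<epsilon> Y g (\<phi> z, \<tau> z))"
proof -
  have "continuous_map Z (thickening \<epsilon> Y) (\<lambda>z. (\<phi> z, \<tau> z))"
    unfolding thickening_def continuous_map_paired
    using assms by (auto intro!: continuous_map_into_subtopology)
  from continuous_map_compose[OF this quotient_imp_continuous_map[OF quotient_map_smooth_class]]
  show ?thesis by (simp add: o_def)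
qed

lemma function_preserving_map_shift_map:
  assumes "continuous_map X euclideanreal f" "continuous_map Y euclideanreal g"
    and "continuous_map X Y \<phi>" and close: "\<And>x. x \<in> topspace X \<Longrightarrow> \<bar>f x - g (\<phi> x)\<bar> \<le> \<epsilon>"
  shows "function_preserving_map X f (smooth_space \<epsilon> Y g) (smooth_fun g) (shift_map \<epsilon> f Y g \<phi>)"
proof -
  have range: "f x - g (\<phi> x) \<in> {-\<epsilon>..\<epsilon>}" if "x \<in> topspace X" for x
    using close[OF that] by auto
  have "continuous_map X euclideanreal (\<lambda>x. f x - g (\<phi> x))"
    using continuous_map_compose[OF assms(3,2)] assms(1) by (auto simp: o_def intro: continuous_map_diff)
  then have "continuous_map X (smooth_space \<epsilon> Y g) (shift_map \<epsilon> f Y g \<phi>)"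
    unfolding shift_map_def using assms(3) range by (intro continuous_map_smooth_class_pair)
  moreover have "smooth_fun g (shift_map \<epsilon> f Y g \<phi> x) = f x" if "x \<in> topspace X" for x
    using continuous_map_image_subset_topspace[OF assms(3)] that range[OF that]
    unfolding shift_map_def by (subst smooth_fun_class) auto
  ultimately show ?thesis
    by (simp add: function_preserving_map_def)
qed

lemma smooth_class_eqI:
  assumes "path_component_of (subtopology (thickening \<epsilon> X) (level_set (thickening \<epsilon> X) (thick_fun f) c)) p q"
  shows "smooth_class \<epsilon> X f p = smooth_class \<epsilon> X f q"
proof -
  have "p \<in> level_set (thickening \<epsilon> X) (thick_fun f) c"
    using path_component_in_topspace[OF assms] by simp
  then have "thick_fun f p = c" by (simp add: level_set_def)
  with assms show ?thesis
    unfolding smooth_class_def by (metis reeb_class_eqI)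
qed

text \<open>Along the path from \<open>u\<close> to \<open>v\<close> the two smoothing coordinates share the height defect
  \<open>f u - f x\<close> equally; as \<open>b - a \<le> 2 * \<epsilon>\<close> each half stays in \<open>{-\<epsilon>..\<epsilon>}\<close>. Over the endpoint \<open>v\<close> the
  shares are then redistributed, with constant sum.\<close>

lemma smooth_class_twice_eq:
  assumes f: "continuous_map X euclideanreal f" and uv: "joined X f a b u v" "b - a \<le> 2 * \<epsilon>"
    and st: "s \<in> {-\<epsilon>..\<epsilon>}" "t \<in> {-\<epsilon>..\<epsilon>}" "f v + s + t = f u"
  shows "smooth_class \<epsilon> (smooth_space \<epsilon> X f) (smooth_fun f) (smooth_class \<epsilon> X f (v, s), t) =
    smooth_class \<epsilon> (smooth_space \<epsilon> X f) (smooth_fun f) (smooth_class \<epsilon> X f (u, 0), 0)"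
proof -
  let ?Z = "smooth_space \<epsilon> X f" and ?h = "smooth_fun f" and ?q = "smooth_class \<epsilon> X f"
  let ?L = "level_set (thickening \<epsilon> ?Z) (thick_fun ?h) (f u)"
  let ?W = "subtopology (thickening \<epsilon> ?Z) ?L"
  define w where "w = f u - f v"
  note uv' = joined_in[OF uv(1)]
  \<comment> \<open>Common recipe for both legs of the path: a base point and two smoothing
    coordinates with constant total height \<open>f u\<close> move within one level set of the twice
    smoothed space.\<close>
  have lift: "continuous_map S ?W (\<lambda>x. (?q (\<alpha> x, \<sigma> x), \<tau> x))"
    if "continuous_map S X \<alpha>" "continuous_map S euclideanreal \<sigma>" "continuous_map S euclideanreal \<tau>"
      and r: "\<And>x. x \<in> topspace S \<Longrightarrow> \<sigma> x \<in> {-\<epsilon>..\<epsilon>} \<and> \<tau> x \<in> {-\<epsilon>..\<epsilon>} \<and> f (\<alpha> x) + \<sigma> x + \<tau> x = f u"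
    for S :: "'s topology" and \<alpha> \<sigma> \<tau>
  proof (rule continuous_map_into_subtopology)
    show c: "continuous_map S (thickening \<epsilon> ?Z) (\<lambda>x. (?q (\<alpha> x, \<sigma> x), \<tau> x))"
      unfolding thickening_def continuous_map_paired using that(1-3) r
      by (auto intro!: continuous_map_smooth_class_pair continuous_map_into_subtopology)
    show "(\<lambda>x. (?q (\<alpha> x, \<sigma> x), \<tau> x)) \<in> topspace S \<rightarrow> ?L"
    proof
      fix x assume x: "x \<in> topspace S"
      then have "\<alpha> x \<in> topspace X"
        using continuous_map_image_subset_topspace[OF that(1)] by blast
      then have "thick_fun ?h (?q (\<alpha> x, \<sigma> x), \<tau> x) = f u"
        using r[OF x] by (simp add: thick_fun_def smooth_fun_class)
      then show "(?q (\<alpha> x, \<sigma> x), \<tau> x) \<in> ?L"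
        using continuous_map_image_subset_topspace[OF c] x by (auto simp: level_set_def)
    qed
  qed
  let ?S = "subtopology X {x. a \<le> f x \<and> f x \<le> b}"
  have fS: "continuous_map ?S euclideanreal f"
    using f by (rule continuous_map_from_subtopology)
  have "continuous_map ?S ?W (\<lambda>x. (?q (x, (f u - f x) / 2), (f u - f x) / 2))"
  proof (rule lift)
    show "continuous_map ?S X (\<lambda>x. x)"
      by (rule continuous_map_from_subtopology) simp
    show "continuous_map ?S euclideanreal (\<lambda>x. (f u - f x) / 2)"
      "continuous_map ?S euclideanreal (\<lambda>x. (f u - f x) / 2)"
      by (intro continuous_intros fS; simp)+
    fix x assume "x \<in> topspace ?S"
    then show "(f u - f x) / 2 \<in> {-\<epsilon>..\<epsilon>} \<and> (f u - f x) / 2 \<in> {-\<epsilon>..\<epsilon>} \<and>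
        f x + (f u - f x) / 2 + (f u - f x) / 2 = f u"
      using uv' uv(2) by (auto simp: field_simps)
  qed
  from path_component_of_continuous_image[OF this uv(1)[unfolded joined_def]]
  have 1: "path_component_of ?W (?q (u, 0), 0) (?q (v, w / 2), w / 2)"
    by (simp add: w_def)
  \<comment> \<open>These are the values of \<open>\<sigma>\<close> for which both
    \<open>\<sigma>\<close> and the remaining share \<open>w - \<sigma>\<close> lie in
    \<open>{-\<epsilon>..\<epsilon>}\<close>.\<close>
  let ?I = "{max (-\<epsilon>) (w - \<epsilon>)..min \<epsilon> (w + \<epsilon>)}"
  have "continuous_map (top_of_set ?I) ?W (\<lambda>\<sigma>. (?q (v, \<sigma>), w - \<sigma>))"
  proof (rule lift)
    show "continuous_map (top_of_set ?I) X (\<lambda>\<sigma>. v)"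
      using uv' by simp
    show "continuous_map (top_of_set ?I) euclideanreal (\<lambda>\<sigma>. \<sigma>)"
      "continuous_map (top_of_set ?I) euclideanreal (\<lambda>\<sigma>. w - \<sigma>)"
      by (simp_all add: continuous_on_diff)
  qed (auto simp: w_def)
  moreover have "path_component_of (top_of_set ?I) (w / 2) s"
  proof -
    have "path_connectedin (top_of_set ?I) ?I"
      by (simp add: path_connectedin_subtopology)
    moreover have "\<bar>w\<bar> \<le> 2 * \<epsilon>" "w = s + t" "\<bar>s\<bar> \<le> \<epsilon>" "\<bar>t\<bar> \<le> \<epsilon>"
      using st uv(2) uv' by (auto simp: w_def)
    then have "w / 2 \<in> ?I" "s \<in> ?I"
      unfolding atLeastAtMost_iff max.bounded_iff min.bounded_iff by linarith+
    ultimately show ?thesis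
      unfolding path_component_of by blast
  qed
  ultimately have 2: "path_component_of ?W (?q (v, w / 2), w - w / 2) (?q (v, s), w - s)"
    by (rule path_component_of_continuous_image)
  have "w - w / 2 = w / 2"
    by simp
  moreover have "w - s = t"
    using st(3) unfolding w_def by linarith
  ultimately have "path_component_of ?W (?q (u, 0), 0) (?q (v, s), t)"
    using path_component_of_trans[OF 1] 2 by simp
  then show ?thesis
    by (rule smooth_class_eqI[symmetric])
qed

text \<open>The composite sends \<open>x\<close> to a double class over
  \<open>\<psi> (\<phi> x)\<close> whose two coordinates
  \<open>g (\<phi> x) - f (\<psi> (\<phi> x))\<close> and \<open>f x - g (\<phi> x)\<close> sum to
  \<open>f x - f (\<psi> (\<phi> x))\<close>. Thus \<open>smooth_class_twice_eq\<close>
  applies.\<close>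

lemma shift_map_compat:
  assumes f: "continuous_map X euclideanreal f" and g: "continuous_map Y euclideanreal g"
    and \<phi>: "continuous_map X Y \<phi>" "\<And>x. x \<in> topspace X \<Longrightarrow> \<bar>f x - g (\<phi> x)\<bar> \<le> \<epsilon>"
    and \<psi>: "continuous_map Y X \<psi>" "\<And>y. y \<in> topspace Y \<Longrightarrow> \<bar>g y - f (\<psi> y)\<bar> \<le> \<epsilon>"
    and x: "x \<in> topspace X" and j: "joined X f a b x (\<psi> (\<phi> x))" "b - a \<le> 2 * \<epsilon>"
  shows "smooth_map \<epsilon> (smooth_space \<epsilon> X f) (smooth_fun f) (shift_map \<epsilon> g X f \<psi>) (shift_map \<epsilon> f Y g \<phi> x) =
    smooth_incl \<epsilon> (smooth_space \<epsilon> X f) (smooth_fun f) (smooth_incl \<epsilon> X f x)"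
proof -
  have y: "\<phi> x \<in> topspace Y"
    using continuous_map_image_subset_topspace[OF \<phi>(1)] x by blast
  have "smooth_map \<epsilon> (smooth_space \<epsilon> X f) (smooth_fun f) (shift_map \<epsilon> g X f \<psi>) (shift_map \<epsilon> f Y g \<phi> x) =
    smooth_class \<epsilon> (smooth_space \<epsilon> X f) (smooth_fun f) (shift_map \<epsilon> g X f \<psi> (\<phi> x), f x - g (\<phi> x))"
    unfolding shift_map_def[of _ f Y]
    by (rule smooth_map_class[OF function_preserving_map_shift_map[OF g f \<psi>] y])
      (use \<phi>(2)[OF x] in auto)
  also have "\<dots> = smooth_incl \<epsilon> (smooth_space \<epsilon> X f) (smooth_fun f) (smooth_incl \<epsilon> X f x)"
    unfolding smooth_incl_def shift_map_def
    by (rule smooth_class_twice_eq[OF f j]) (use \<phi>(2)[OF x] \<psi>(2)[OF y] in auto)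
  finally show ?thesis .
qed

section \<open>Distortion and round trips\<close>

lemma ennreal_absdiff_0: "ennreal_absdiff a 0 = a"
  by (simp add: ennreal_absdiff_def)

lemma ennreal_absdiff_commute: "ennreal_absdiff a b = ennreal_absdiff b a"
  by (simp add: ennreal_absdiff_def max.commute)

lemma distortion_upper:
  assumes "(x, y) \<in> correspondence X Y \<phi> \<psi>" "(x', y') \<in> correspondence X Y \<phi> \<psi>"
  shows "ennreal_absdiff (height_dist X f x x') (height_dist Y g y y') / 2 \<le> distortion X f Y g \<phi> \<psi>"
  unfolding distortion_def
  by (rule SUP_upper2[OF assms(1)], simp, rule SUP_upper2[OF assms(2)], simp)

lemma distortion_least:
  assumes "\<And>x y x' y'. (x, y) \<in> correspondence X Y \<phi> \<psi> \<Longrightarrow> (x', y') \<in> correspondence X Y \<phi> \<psi> \<Longrightarrow>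
    ennreal_absdiff (height_dist X f x x') (height_dist Y g y y') / 2 \<le> c"
  shows "distortion X f Y g \<phi> \<psi> \<le> c"
  unfolding distortion_def using assms by (auto intro!: SUP_least)

lemma distortion_commute_le: "distortion Y g X f \<psi> \<phi> \<le> distortion X f Y g \<phi> \<psi>"
proof (rule distortion_least)
  fix y x y' x'
  assume "(y, x) \<in> correspondence Y X \<psi> \<phi>" "(y', x') \<in> correspondence Y X \<psi> \<phi>"
  then have "(x, y) \<in> correspondence X Y \<phi> \<psi>" "(x', y') \<in> correspondence X Y \<phi> \<psi>"
    by (auto simp: correspondence_def)
  then show "ennreal_absdiff (height_dist Y g y y') (height_dist X f x x') / 2 \<le> distortion X f Y g \<phi> \<psi>"
    by (subst ennreal_absdiff_commute) (rule distortion_upper)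
qed

lemma distortion_commute: "distortion Y g X f \<psi> \<phi> = distortion X f Y g \<phi> \<psi>"
  by (rule antisym; rule distortion_commute_le)

text \<open>Both \<open>(x, \<phi> x)\<close> and \<open>(\<psi> (\<phi> x), \<phi> x)\<close> lie
  in the correspondence. Their second entries coincide, so the distortion bounds half the height
  distance from \<open>x\<close> to \<open>\<psi> (\<phi> x)\<close>.\<close>

lemma joined_round_trip:
  assumes f: "continuous_map X euclideanreal f" and \<phi>: "continuous_map X Y \<phi>" and \<psi>: "continuous_map Y X \<psi>"
    and D: "distortion X f Y g \<phi> \<psi> < ennreal \<epsilon>" and x: "x \<in> topspace X"
  obtains a b where "joined X f a b x (\<psi> (\<phi> x))" "b - a \<le> 2 * \<epsilon>"
proof -
  have y: "\<phi> x \<in> topspace Y" and x': "\<psi> (\<phi> x) \<in> topspace X"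
    using continuous_map_image_subset_topspace[OF \<phi>] continuous_map_image_subset_topspace[OF \<psi>] x by auto
  then have "ennreal_absdiff (height_dist X f x (\<psi> (\<phi> x))) (height_dist Y g (\<phi> x) (\<phi> x)) / 2
      \<le> distortion X f Y g \<phi> \<psi>"
    using x by (intro distortion_upper) (auto simp: correspondence_def)
  then have "height_dist X f x (\<psi> (\<phi> x)) / 2 < ennreal \<epsilon>"
    using D by (simp add: height_dist_refl[OF y] ennreal_absdiff_0)
  then have "height_dist X f x (\<psi> (\<phi> x)) < ennreal \<epsilon> * 2"
    by (simp add: divide_less_ennreal)
  also have "ennreal \<epsilon> * 2 = ennreal (2 * \<epsilon>)"
    using ennreal_mult''[of 2 \<epsilon>] by (simp add: mult.commute)
  finally have less: "height_dist X f x (\<psi> (\<phi> x)) < ennreal (2 * \<epsilon>)" .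
  obtain a b where "joined X f a b x (\<psi> (\<phi> x))" "b - a < 2 * \<epsilon>"
    using height_dist_less_joined[OF less f] .
  then show thesis
    by (intro that less_imp_le)
qed

text \<open>The sup distances keep the smoothing coordinates in range, and the distortion gives the
  round trips behind the two commutativity conditions. The strict bound is what provides actual
  paths for them.\<close>

lemma interleaving_shift_maps:
  assumes f: "continuous_map X euclideanreal f" and g: "continuous_map Y euclideanreal g"
    and \<phi>: "continuous_map X Y \<phi>" and \<psi>: "continuous_map Y X \<psi>" and "0 \<le> \<epsilon>"
    and bound: "max (distortion X f Y g \<phi> \<psi>) (max (sup_dist X f (g \<circ> \<phi>)) (sup_dist Y g (f \<circ> \<psi>))) < ennreal \<epsilon>"
  shows "interleaving \<epsilon> X f Y g (shift_map \<epsilon> f Y g \<phi>) (shift_map \<epsilon> g X f \<psi>)"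
proof -
  have le: "\<bar>h x - k x\<bar> \<le> \<epsilon>" if "sup_dist Z h k < ennreal \<epsilon>" "x \<in> topspace Z"
    for Z :: "'z topology" and h k x
  proof -
    have "ennreal \<bar>h x - k x\<bar> \<le> sup_dist Z h k"
      unfolding sup_dist_def using that(2) by (rule SUP_upper)
    with that(1) have "ennreal \<bar>h x - k x\<bar> \<le> ennreal \<epsilon>" by (metis le_less_trans less_imp_le)
    then show ?thesis using \<open>0 \<le> \<epsilon>\<close> by (simp add: ennreal_le_iff)
  qed
  have c\<phi>: "\<bar>f x - g (\<phi> x)\<bar> \<le> \<epsilon>" if "x \<in> topspace X" for x
    using le[of X f "g \<circ> \<phi>" x] bound that by simp
  have c\<psi>: "\<bar>g y - f (\<psi> y)\<bar> \<le> \<epsilon>" if "y \<in> topspace Y" for y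
    using le[of Y g "f \<circ> \<psi>" y] bound that by simp
  have D: "distortion X f Y g \<phi> \<psi> < ennreal \<epsilon>"
    using bound by simp
  then have D': "distortion Y g X f \<psi> \<phi> < ennreal \<epsilon>"
    by (subst distortion_commute)
  show ?thesis
    unfolding interleaving_def
  proof (intro conjI ballI)
    show "function_preserving_map X f (smooth_space \<epsilon> Y g) (smooth_fun g) (shift_map \<epsilon> f Y g \<phi>)"
      using f g \<phi> c\<phi> by (rule function_preserving_map_shift_map)
    show "function_preserving_map Y g (smooth_space \<epsilon> X f) (smooth_fun f) (shift_map \<epsilon> g X f \<psi>)"
      using g f \<psi> c\<psi> by (rule function_preserving_map_shift_map)
  next
    fix x assume x: "x \<in> topspace X"
    obtain a b where ab: "joined X f a b x (\<psi> (\<phi> x))" "b - a \<le> 2 * \<epsilon>"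
      using joined_round_trip[OF f \<phi> \<psi> D x] .
    show "smooth_map \<epsilon> (smooth_space \<epsilon> X f) (smooth_fun f) (shift_map \<epsilon> g X f \<psi>) (shift_map \<epsilon> f Y g \<phi> x) =
        smooth_incl \<epsilon> (smooth_space \<epsilon> X f) (smooth_fun f) (smooth_incl \<epsilon> X f x)"
      using f g \<phi> c\<phi> \<psi> c\<psi> x ab by (rule shift_map_compat)
  next
    fix y assume y: "y \<in> topspace Y"
    obtain a b where ab: "joined Y g a b y (\<phi> (\<psi> y))" "b - a \<le> 2 * \<epsilon>"
      using joined_round_trip[OF g \<psi> \<phi> D' y] .
    show "smooth_map \<epsilon> (smooth_space \<epsilon> Y g) (smooth_fun g) (shift_map \<epsilon> f Y g \<phi>) (shift_map \<epsilon> g X f \<psi> y) =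
        smooth_incl \<epsilon> (smooth_space \<epsilon> Y g) (smooth_fun g) (smooth_incl \<epsilon> Y g y)"
      using g f \<psi> c\<psi> \<phi> c\<phi> y ab by (rule shift_map_compat)
  qed
qed

lemma interleaving_dist_le_functional_distortion_dist:
  assumes f: "continuous_map X euclideanreal f" and g: "continuous_map Y euclideanreal g"
  shows "interleaving_dist X f Y g \<le> functional_distortion_dist X f Y g"
  unfolding functional_distortion_dist_def
proof (rule INF_greatest, clarsimp simp only: case_prod_conv mem_Collect_eq split_paired_all)
  fix \<phi> \<psi> assume \<phi>\<psi>: "continuous_map X Y \<phi>" "continuous_map Y X \<psi>"
  let ?M = "max (distortion X f Y g \<phi> \<psi>) (max (sup_dist X f (g \<circ> \<phi>)) (sup_dist Y g (f \<circ> \<psi>)))"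
  show "interleaving_dist X f Y g \<le> ?M"
  proof (rule ennreal_le_epsilon)
    fix e :: real assume "?M < top" "0 < e"
    \<comment> \<open>The added \<open>e\<close> makes \<open>\<epsilon>\<close> strictly larger
      than the finite maximum.\<close>
    define \<epsilon> where "\<epsilon> = enn2real ?M + e"
    have M: "ennreal \<epsilon> = ?M + ennreal e"
      using \<open>?M < top\<close> \<open>0 < e\<close> by (simp add: \<epsilon>_def ennreal_plus)
    have "0 \<le> \<epsilon>" using \<open>0 < e\<close> by (simp add: \<epsilon>_def)
    have "?M < ennreal \<epsilon>"
      unfolding M using ennreal_add_left_cancel_less[of ?M 0 "ennreal e"] \<open>?M < top\<close> \<open>0 < e\<close>
      by (simp add: less_top)
    then have "interleaving \<epsilon> X f Y g (shift_map \<epsilon> f Y g \<phi>) (shift_map \<epsilon> g X f \<psi>)"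
      by (rule interleaving_shift_maps[OF f g \<phi>\<psi> \<open>0 \<le> \<epsilon>\<close>])
    then have "interleaving_dist X f Y g \<le> ennreal \<epsilon>"
      unfolding interleaving_dist_def using \<open>0 \<le> \<epsilon>\<close> by (intro INF_lower) blast
    then show "interleaving_dist X f Y g \<le> ?M + ennreal e"
      by (simp only: M)
  qed
qed


section \<open>From interleavings to distortion\<close>

text \<open>Here \<open>\<phi>\<close> is a coarse representative of \<open>\<Phi>\<close>. The
  condition concerns every pair \<open>(y, t)\<close> in the class \<open>\<Phi> x\<close>, so that
  later arguments may pick any representative.\<close>

definition follows ::
  "real \<Rightarrow> real \<Rightarrow> 'a topology \<Rightarrow> ('a \<Rightarrow> real) \<Rightarrow> 'b topology \<Rightarrow> ('b \<Rightarrow> real) \<Rightarrow>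
   ('a \<Rightarrow> ('b \<times> real) set) \<Rightarrow> ('a \<Rightarrow> 'b) \<Rightarrow> bool" where
  "follows \<epsilon> r X f Y g \<Phi> \<phi> \<longleftrightarrow> continuous_map X Y \<phi> \<and>
     (\<forall>x\<in>topspace X. \<forall>y\<in>topspace Y. \<forall>t\<in>{-\<epsilon>..\<epsilon>}. smooth_class \<epsilon> Y g (y, t) = \<Phi> x \<longrightarrow>
        joined Y g (f x - r) (f x + r) (\<phi> x) y)"

lemma followsD:
  assumes "follows \<epsilon> r X f Y g \<Phi> \<phi>"
  shows "continuous_map X Y \<phi>"
    and "\<lbrakk>x \<in> topspace X; y \<in> topspace Y; t \<in> {-\<epsilon>..\<epsilon>}; smooth_class \<epsilon> Y g (y, t) = \<Phi> x\<rbrakk> \<Longrightarrow>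
      joined Y g (f x - r) (f x + r) (\<phi> x) y"
  using assms unfolding follows_def by blast+

lemma function_preserving_map_class:
  assumes "function_preserving_map X f (smooth_space \<epsilon> Y g) (smooth_fun g) \<Phi>" "x \<in> topspace X"
  obtains y t where "y \<in> topspace Y" "t \<in> {-\<epsilon>..\<epsilon>}" "\<Phi> x = smooth_class \<epsilon> Y g (y, t)" "g y + t = f x"
proof -
  have "\<Phi> x \<in> topspace (smooth_space \<epsilon> Y g)"
    using assms continuous_map_image_subset_topspace unfolding function_preserving_map_def by blast
  then obtain y t where "y \<in> topspace Y" "t \<in> {-\<epsilon>..\<epsilon>}" "\<Phi> x = smooth_class \<epsilon> Y g (y, t)"
    by (rule smooth_classE)
  moreover from this have "g y + t = f x"
    using assms smooth_fun_class unfolding function_preserving_map_def by metis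
  ultimately show thesis by (rule that)
qed

lemma follows_close:
  assumes "function_preserving_map X f (smooth_space \<epsilon> Y g) (smooth_fun g) \<Phi>"
    and "follows \<epsilon> r X f Y g \<Phi> \<phi>" "x \<in> topspace X"
  shows "\<bar>g (\<phi> x) - f x\<bar> \<le> r"
proof -
  obtain y t where y: "y \<in> topspace Y" "t \<in> {-\<epsilon>..\<epsilon>}" "\<Phi> x = smooth_class \<epsilon> Y g (y, t)"
    using function_preserving_map_class[OF assms(1,3)] by metis
  have "joined Y g (f x - r) (f x + r) (\<phi> x) y"
    using followsD(2)[OF assms(2,3) y(1,2) y(3)[symmetric]] .
  from joined_in(3,4)[OF this] show ?thesis by linarith
qed

text \<open>The map \<open>\<Phi>\<close> is lifted to the thickening with height error
  \<open>\<delta>\<close>, and projecting to \<open>Y\<close> adds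
  \<open>\<epsilon>\<close>.\<close>

lemma follows_exists:
  assumes X: "finite_graph X V E" and Y: "locally_path_connected_space Y" and g: "continuous_map Y euclideanreal g"
    and \<Phi>: "function_preserving_map X f (smooth_space \<epsilon> Y g) (smooth_fun g) \<Phi>" and "\<delta> > 0"
  obtains \<phi> where "follows \<epsilon> (\<epsilon> + \<delta>) X f Y g \<Phi> \<phi>"
proof -
  let ?T = "thickening \<epsilon> Y" and ?q = "smooth_class \<epsilon> Y g" and ?h = "smooth_fun g"
  have c: "continuous_map X (smooth_space \<epsilon> Y g) \<Phi>"
    and pres: "\<And>x. x \<in> topspace X \<Longrightarrow> ?h (\<Phi> x) = f x"
    using \<Phi> by (auto simp: function_preserving_map_def)
  obtain F where F: "continuous_map X ?T F"
    "\<And>x r. \<lbrakk>x \<in> topspace X; r \<in> topspace ?T; ?q r = \<Phi> x\<rbrakk> \<Longrightarrow>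
       path_component_of (subtopology ?T {s. \<bar>?h (?q s) - ?h (\<Phi> x)\<bar> < \<delta>}) (F x) r"
    using approximate_graph_lift[OF X locally_path_connected_space_thickening[OF Y]
      quotient_map_smooth_class path_connectedin_smooth_class_fibres continuous_map_smooth_fun[OF g]
      \<open>\<delta> > 0\<close> c] by blast
  have "follows \<epsilon> (\<epsilon> + \<delta>) X f Y g \<Phi> (fst \<circ> F)"
    unfolding follows_def
  proof (intro conjI ballI impI)
    show "continuous_map X Y (fst \<circ> F)"
      using F(1) unfolding thickening_def continuous_map_pairwise by blast
  next
    fix x y t
    assume x: "x \<in> topspace X" and y: "y \<in> topspace Y" "t \<in> {-\<epsilon>..\<epsilon>}" "?q (y, t) = \<Phi> x"
    have "path_component_of (subtopology ?T {s. \<bar>?h (?q s) - ?h (\<Phi> x)\<bar> < \<delta>}) (F x) (y, t)"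
      using y by (intro F(2) x) (auto simp: topspace_thickening)
    then have "joined ?T (thick_fun g) (f x - \<delta>) (f x + \<delta>) (F x) (y, t)"
      unfolding joined_def
    proof (rule path_component_of_subtopology_mono)
      fix p assume p: "p \<in> topspace ?T" "p \<in> {s. \<bar>?h (?q s) - ?h (\<Phi> x)\<bar> < \<delta>}"
      then have "?h (?q p) = thick_fun g p"
        by (cases p) (simp add: topspace_thickening smooth_fun_class thick_fun_def)
      then show "p \<in> {p. f x - \<delta> \<le> thick_fun g p \<and> thick_fun g p \<le> f x + \<delta>}"
        using p(2) pres[OF x] by (simp add: abs_less_iff)
    qed
    then have "joined Y g (f x - \<delta> - \<epsilon>) (f x + \<delta> + \<epsilon>) (fst (F x)) y"
      using joined_thickening_fst[of \<epsilon> Y g _ _ "fst (F x)" "snd (F x)"] by simp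
    then show "joined Y g (f x - (\<epsilon> + \<delta>)) (f x + (\<epsilon> + \<delta>)) ((fst \<circ> F) x) y"
      by (simp add: algebra_simps)
  qed
  then show thesis by (rule that)
qed

text \<open>Equal classes are joined inside a level set of the thickening; the path projects to
  \<open>Z\<close> with height error at most \<open>\<epsilon>\<close>.\<close>

lemma joined_smooth_class_twice:
  assumes "smooth_class \<epsilon> Z h (z, s) = smooth_class \<epsilon> Z h (z', s')"
    and "z \<in> topspace Z" "s \<in> {-\<epsilon>..\<epsilon>}" "z' \<in> topspace Z" "s' \<in> {-\<epsilon>..\<epsilon>}"
  shows "joined Z h (h z + s - \<epsilon>) (h z + s + \<epsilon>) z z'"
proof -
  have "(z', s') \<in> smooth_class \<epsilon> Z h (z, s)"
    unfolding assms(1) using assms(4,5)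
    by (simp add: smooth_class_def reeb_class_self topspace_thickening)
  then have "path_component_of (subtopology (thickening \<epsilon> Z)
      (level_set (thickening \<epsilon> Z) (thick_fun h) (h z + s))) (z, s) (z', s')"
    by (simp add: smooth_class_def reeb_class_def thick_fun_def)
  then have "joined (thickening \<epsilon> Z) (thick_fun h) (h z + s) (h z + s) (z, s) (z', s')"
    unfolding joined_def
    by (rule path_component_of_subtopology_mono) (simp add: level_set_def)
  then show ?thesis
    by (rule joined_thickening_fst)
qed

text \<open>Let \<open>(y, t)\<close> represent \<open>\<Phi> x\<close> and \<open>(x', s)\<close>
  represent \<open>\<Psi> (\<phi> x)\<close>. In the smoothing of \<open>X\<close>, the connection
  runs from \<open>\<Psi> (\<phi> x)\<close> over \<open>\<Psi> y\<close> to the class of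
  \<open>(x, 0)\<close> within \<open>r\<close> of \<open>f x\<close>. Lifting it joins
  \<open>x'\<close> to \<open>x\<close> within \<open>2 * r\<close>, and
  \<open>\<psi> (\<phi> x)\<close> is joined to \<open>x'\<close> because \<open>\<psi>\<close>
  follows \<open>\<Psi>\<close>.\<close>

lemma joined_follows_round_trip:
  assumes X: "locally_path_connected_space X" and f: "continuous_map X euclideanreal f"
    and "0 \<le> \<epsilon>" "\<delta> > 0" and r: "r = \<epsilon> + \<delta>"
    and \<Phi>: "function_preserving_map X f (smooth_space \<epsilon> Y g) (smooth_fun g) \<Phi>"
    and \<Psi>: "function_preserving_map Y g (smooth_space \<epsilon> X f) (smooth_fun f) \<Psi>"
    and comm: "smooth_map \<epsilon> (smooth_space \<epsilon> X f) (smooth_fun f) \<Psi> (\<Phi> x) =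
        smooth_incl \<epsilon> (smooth_space \<epsilon> X f) (smooth_fun f) (smooth_incl \<epsilon> X f x)"
    and \<phi>: "follows \<epsilon> r X f Y g \<Phi> \<phi>" and \<psi>: "follows \<epsilon> r Y g X f \<Psi> \<psi>"
    and x: "x \<in> topspace X"
  shows "joined X f (f x - 2 * r) (f x + 2 * r) (\<psi> (\<phi> x)) x"
proof -
  let ?Z = "smooth_space \<epsilon> X f" and ?h = "smooth_fun f" and ?q = "smooth_class \<epsilon> X f"
  have \<Psi>c: "continuous_map Y ?Z \<Psi>" and \<Psi>h: "\<And>y. y \<in> topspace Y \<Longrightarrow> ?h (\<Psi> y) = g y"
    using \<Psi> by (auto simp: function_preserving_map_def)
  have \<phi>x: "\<phi> x \<in> topspace Y"
    using continuous_map_image_subset_topspace[OF followsD(1)[OF \<phi>]] x by blast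
  obtain y t where y: "y \<in> topspace Y" "t \<in> {-\<epsilon>..\<epsilon>}" "\<Phi> x = smooth_class \<epsilon> Y g (y, t)" "g y + t = f x"
    using function_preserving_map_class[OF \<Phi> x] .
  have "joined Y g (f x - r) (f x + r) (\<phi> x) y"
    by (rule followsD(2)[OF \<phi> x y(1,2) y(3)[symmetric]])
  then have "joined ?Z ?h (f x - r - 0) (f x + r + 0) (\<Psi> (\<phi> x)) (\<Psi> y)"
    by (rule joined_image[OF _ \<Psi>c]) (simp add: \<Psi>h)
  then have 1: "joined ?Z ?h (f x - r) (f x + r) (\<Psi> (\<phi> x)) (\<Psi> y)"
    by simp
  \<comment> \<open>Commutativity is evaluated on the representative \<open>(y, t)\<close> of
    \<open>\<Phi> x\<close>.\<close>
  have "smooth_class \<epsilon> ?Z ?h (\<Psi> y, t) = smooth_class \<epsilon> ?Z ?h (?q (x, 0), 0)"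
    using comm unfolding y(3) smooth_map_class[OF \<Psi> y(1,2)] smooth_incl_def .
  then have "joined ?Z ?h (?h (\<Psi> y) + t - \<epsilon>) (?h (\<Psi> y) + t + \<epsilon>) (\<Psi> y) (?q (x, 0))"
    by (rule joined_smooth_class_twice)
      (use continuous_map_image_subset_topspace[OF \<Psi>c] y(1,2) x \<open>0 \<le> \<epsilon>\<close> in \<open>auto intro: smooth_class_in_topspace\<close>)
  then have "joined ?Z ?h (f x - r) (f x + r) (\<Psi> y) (?q (x, 0))"
    by (rule joined_mono) (use r \<open>\<delta> > 0\<close> y(4) \<Psi>h[OF y(1)] in auto)
  with 1 have 2: "joined ?Z ?h (f x - r) (f x + r) (\<Psi> (\<phi> x)) (?q (x, 0))"
    by (rule joined_trans)
  obtain x' s where x': "x' \<in> topspace X" "s \<in> {-\<epsilon>..\<epsilon>}" "\<Psi> (\<phi> x) = ?q (x', s)"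
    using function_preserving_map_class[OF \<Psi> \<phi>x] by metis
  have "joined X f (f x - r - (\<epsilon> + \<delta>)) (f x + r + (\<epsilon> + \<delta>)) x' x"
    using 2 unfolding x'(3)
    by (rule joined_smooth_space_lift[OF X f _ \<open>\<delta> > 0\<close>]) (use x x' \<open>0 \<le> \<epsilon>\<close> in auto)
  then have 3: "joined X f (f x - 2 * r) (f x + 2 * r) x' x"
    by (rule joined_mono) (use r in auto)
  have "joined X f (g (\<phi> x) - r) (g (\<phi> x) + r) (\<psi> (\<phi> x)) x'"
    by (rule followsD(2)[OF \<psi> \<phi>x x'(1,2) x'(3)[symmetric]])
  then have "joined X f (f x - 2 * r) (f x + 2 * r) (\<psi> (\<phi> x)) x'"
    by (rule joined_mono) (use follows_close[OF \<Phi> \<phi> x] in linarith)+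
  then show ?thesis
    using 3 by (rule joined_trans)
qed

text \<open>The path is transported by \<open>\<psi>\<close>, widening its band by \<open>r\<close>,
  and its ends are then connected to \<open>x\<close> and \<open>x'\<close>. If
  \<open>\<phi> x = y\<close>, the round trip stays within \<open>2 * r\<close> of
  \<open>f x\<close>, hence within \<open>3 * r\<close> of \<open>g y\<close>; if
  \<open>x = \<psi> y\<close>, the constant path suffices.\<close>

lemma joined_correspondence:
  assumes \<phi>: "\<And>x. x \<in> topspace X \<Longrightarrow> \<bar>g (\<phi> x) - f x\<bar> \<le> r"
    and \<psi>: "continuous_map Y X \<psi>" "\<And>y. y \<in> topspace Y \<Longrightarrow> \<bar>f (\<psi> y) - g y\<bar> \<le> r"
    and round: "\<And>x. x \<in> topspace X \<Longrightarrow> joined X f (f x - 2 * r) (f x + 2 * r) (\<psi> (\<phi> x)) x"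
    and xy: "(x, y) \<in> correspondence X Y \<phi> \<psi>" "(x', y') \<in> correspondence X Y \<phi> \<psi>"
    and j: "joined Y g a b y y'"
  shows "joined X f (a - 3 * r) (b + 3 * r) x x'"
proof -
  have "joined X f (g y - 3 * r) (g y + 3 * r) (\<psi> y) x" if xy: "(x, y) \<in> correspondence X Y \<phi> \<psi>" for x y
  proof -
    have x: "x \<in> topspace X" and y: "y \<in> topspace Y" and "\<phi> x = y \<or> x = \<psi> y"
      using xy by (auto simp: correspondence_def)
    from this(3) show ?thesis
    proof
      assume "\<phi> x = y"
      then have "joined X f (f x - 2 * r) (f x + 2 * r) (\<psi> y) x"
        using round[OF x] by simp
      then show ?thesis
        by (rule joined_mono) (use \<phi>[OF x] \<open>\<phi> x = y\<close> in auto)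
    next
      assume "x = \<psi> y"
      then show ?thesis
        using \<psi>(2)[OF y] x by (auto intro!: joined_refl)
    qed
  qed
  note ends = this[OF xy(1)] this[OF xy(2)]
  \<comment> \<open>The endpoint \<open>y\<close> shows that \<open>Y\<close> is nonempty, so
    \<open>r\<close> bounds some absolute value.\<close>
  have "r \<ge> 0"
    using joined_in(1)[OF j] \<psi>(2) by (meson abs_ge_zero order_trans)
  have "joined X f (a - r) (b + r) (\<psi> y) (\<psi> y')"
    using j \<psi> by (rule joined_image)
  then have "joined X f (a - 3 * r) (b + 3 * r) (\<psi> y) (\<psi> y')"
    by (rule joined_mono) (use \<open>r \<ge> 0\<close> in auto)
  moreover have "joined X f (a - 3 * r) (b + 3 * r) (\<psi> y) x" "joined X f (a - 3 * r) (b + 3 * r) (\<psi> y') x'"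
    using joined_in[OF j] by (auto intro: joined_mono[OF ends(1)] joined_mono[OF ends(2)])
  ultimately show ?thesis
    using joined_sym joined_trans by metis
qed

text \<open>The two bounds make \<open>a\<close> and \<open>b\<close> infinite together, in which
  case the difference is \<open>0\<close> by convention.\<close>

lemma ennreal_absdiff_le:
  "a \<le> b + ennreal c \<Longrightarrow> b \<le> a + ennreal c \<Longrightarrow> ennreal_absdiff a b \<le> ennreal c"
  by (auto simp: ennreal_absdiff_def ennreal_minus_le_iff)

text \<open>Transport in either direction widens bands by \<open>3 * r\<close> at both ends; the
  resulting difference \<open>6 * r\<close> is halved in the distortion. The sup distances are at
  most \<open>r\<close>.\<close>

lemma functional_distortion_dist_le:
  assumes X: "finite_graph X V E" and f: "continuous_map X euclideanreal f"
    and Y: "finite_graph Y V' E'" and g: "continuous_map Y euclideanreal g"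
    and "0 \<le> \<epsilon>" "\<delta> > 0" and I: "interleaving \<epsilon> X f Y g \<Phi> \<Psi>"
  shows "functional_distortion_dist X f Y g \<le> ennreal (3 * (\<epsilon> + \<delta>))"
proof -
  define r where "r = \<epsilon> + \<delta>"
  have "r \<ge> 0" using \<open>0 \<le> \<epsilon>\<close> \<open>\<delta> > 0\<close> by (simp add: r_def)
  note lX = locally_path_connected_space_graph[OF X]
  note lY = locally_path_connected_space_graph[OF Y]
  have \<Phi>: "function_preserving_map X f (smooth_space \<epsilon> Y g) (smooth_fun g) \<Phi>"
    and \<Psi>: "function_preserving_map Y g (smooth_space \<epsilon> X f) (smooth_fun f) \<Psi>"
    and comm1: "\<And>x. x \<in> topspace X \<Longrightarrow> smooth_map \<epsilon> (smooth_space \<epsilon> X f) (smooth_fun f) \<Psi> (\<Phi> x) =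
        smooth_incl \<epsilon> (smooth_space \<epsilon> X f) (smooth_fun f) (smooth_incl \<epsilon> X f x)"
    and comm2: "\<And>y. y \<in> topspace Y \<Longrightarrow> smooth_map \<epsilon> (smooth_space \<epsilon> Y g) (smooth_fun g) \<Phi> (\<Psi> y) =
        smooth_incl \<epsilon> (smooth_space \<epsilon> Y g) (smooth_fun g) (smooth_incl \<epsilon> Y g y)"
    using I by (simp_all add: interleaving_def)
  obtain \<phi> where \<phi>: "follows \<epsilon> r X f Y g \<Phi> \<phi>"
    using follows_exists[OF X lY g \<Phi> \<open>\<delta> > 0\<close>] unfolding r_def .
  obtain \<psi> where \<psi>: "follows \<epsilon> r Y g X f \<Psi> \<psi>"
    using follows_exists[OF Y lX f \<Psi> \<open>\<delta> > 0\<close>] unfolding r_def .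
  note c\<phi> = follows_close[OF \<Phi> \<phi>] and c\<psi> = follows_close[OF \<Psi> \<psi>]
  note cont = followsD(1)[OF \<phi>] followsD(1)[OF \<psi>]
  have rX: "joined X f (f x - 2 * r) (f x + 2 * r) (\<psi> (\<phi> x)) x" if "x \<in> topspace X" for x
    by (rule joined_follows_round_trip[OF lX f \<open>0 \<le> \<epsilon>\<close> \<open>\<delta> > 0\<close> r_def \<Phi> \<Psi> comm1[OF that] \<phi> \<psi> that])
  have rY: "joined Y g (g y - 2 * r) (g y + 2 * r) (\<phi> (\<psi> y)) y" if "y \<in> topspace Y" for y
    by (rule joined_follows_round_trip[OF lY g \<open>0 \<le> \<epsilon>\<close> \<open>\<delta> > 0\<close> r_def \<Psi> \<Phi> comm2[OF that] \<psi> \<phi> that])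
  have "distortion X f Y g \<phi> \<psi> \<le> ennreal (3 * r)"
  proof (rule distortion_least)
    fix x y x' y'
    assume xy: "(x, y) \<in> correspondence X Y \<phi> \<psi>" "(x', y') \<in> correspondence X Y \<phi> \<psi>"
    then have yx: "(y, x) \<in> correspondence Y X \<psi> \<phi>" "(y', x') \<in> correspondence Y X \<psi> \<phi>"
      by (auto simp: correspondence_def)
    have "height_dist X f x x' \<le> height_dist Y g y y' + ennreal (2 * (3 * r))"
    proof (rule height_dist_perturb[OF g])
      show "joined X f (a - 3 * r) (b + 3 * r) x x'" if "joined Y g a b y y'" for a b
        using c\<phi> cont(2) c\<psi> rX xy that by (rule joined_correspondence)
    qed (use \<open>r \<ge> 0\<close> in simp)
    moreover have "height_dist Y g y y' \<le> height_dist X f x x' + ennreal (2 * (3 * r))"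
    proof (rule height_dist_perturb[OF f])
      show "joined Y g (a - 3 * r) (b + 3 * r) y y'" if "joined X f a b x x'" for a b
        using c\<psi> cont(1) c\<phi> rY yx that by (rule joined_correspondence)
    qed (use \<open>r \<ge> 0\<close> in simp)
    ultimately have "ennreal_absdiff (height_dist X f x x') (height_dist Y g y y') \<le> ennreal (2 * (3 * r))"
      by (rule ennreal_absdiff_le)
    then have "ennreal_absdiff (height_dist X f x x') (height_dist Y g y y') / 2 \<le> ennreal (2 * (3 * r)) / 2"
      by (rule divide_right_mono_ennreal)
    also have "\<dots> = ennreal (3 * r)"
      using \<open>r \<ge> 0\<close> divide_ennreal[of "2 * (3 * r)" 2] by simp
    finally show "ennreal_absdiff (height_dist X f x x') (height_dist Y g y y') / 2 \<le> ennreal (3 * r)" .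
  qed
  moreover have "sup_dist X f (g \<circ> \<phi>) \<le> ennreal (3 * r)"
    unfolding sup_dist_def
  proof (rule SUP_least, rule ennreal_leI)
    fix x assume "x \<in> topspace X"
    from c\<phi>[OF this] show "\<bar>f x - (g \<circ> \<phi>) x\<bar> \<le> 3 * r"
      unfolding comp_apply using \<open>r \<ge> 0\<close> by linarith
  qed
  moreover have "sup_dist Y g (f \<circ> \<psi>) \<le> ennreal (3 * r)"
    unfolding sup_dist_def
  proof (rule SUP_least, rule ennreal_leI)
    fix y assume "y \<in> topspace Y"
    from c\<psi>[OF this] show "\<bar>g y - (f \<circ> \<psi>) y\<bar> \<le> 3 * r"
      unfolding comp_apply using \<open>r \<ge> 0\<close> by linarith
  qed
  ultimately show ?thesis
    unfolding functional_distortion_dist_def r_def[symmetric] using cont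
    by (intro INF_lower2[of "(\<phi>, \<psi>)"]) simp_all
qed

text \<open>With the factor on the left, the estimate for each single interleaving passes directly
  to the infimum.\<close>

lemma functional_distortion_dist_le_interleaving_dist:
  assumes "reeb_graph X f" "reeb_graph Y g"
  shows "ennreal (1 / 7) * functional_distortion_dist X f Y g \<le> interleaving_dist X f Y g"
  unfolding interleaving_dist_def
proof (rule INF_greatest, clarify)
  fix \<epsilon> :: real and \<Phi> \<Psi> assume \<epsilon>: "0 \<le> \<epsilon>" and I: "interleaving \<epsilon> X f Y g \<Phi> \<Psi>"
  obtain V E where X: "finite_graph X V E" and f: "continuous_map X euclideanreal f"
    using assms(1) unfolding reeb_graph_def by blast
  obtain V' E' where Y: "finite_graph Y V' E'" and g: "continuous_map Y euclideanreal g"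
    using assms(2) unfolding reeb_graph_def by blast
  have "functional_distortion_dist X f Y g \<le> ennreal (7 * \<epsilon>)"
  proof (rule ennreal_le_epsilon)
    fix e :: real assume "0 < e"
    \<comment> \<open>Lifting with error \<open>e / 3\<close> gives
      \<open>3 * \<epsilon> + e\<close>, so the arbitrary slack \<open>e\<close> also covers
      \<open>\<epsilon> = 0\<close>.\<close>
    have "functional_distortion_dist X f Y g \<le> ennreal (3 * (\<epsilon> + e / 3))"
      using \<open>0 < e\<close> by (intro functional_distortion_dist_le[OF X f Y g \<epsilon> _ I]) simp
    also have "\<dots> \<le> ennreal (7 * \<epsilon> + e)"
      using \<epsilon> by (intro ennreal_leI) simp
    also have "\<dots> = ennreal (7 * \<epsilon>) + ennreal e"
      using \<epsilon> \<open>0 < e\<close> by (intro ennreal_plus) simp_all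
    finally show "functional_distortion_dist X f Y g \<le> ennreal (7 * \<epsilon>) + ennreal e" .
  qed
  then have "ennreal (1 / 7) * functional_distortion_dist X f Y g \<le> ennreal (1 / 7) * ennreal (7 * \<epsilon>)"
    by (rule mult_left_mono) simp
  also have "\<dots> = ennreal \<epsilon>"
    by (subst ennreal_mult'[symmetric]) simp_all
  finally show "ennreal (1 / 7) * functional_distortion_dist X f Y g \<le> ennreal \<epsilon>" .
qed

theorem theorem14:
  fixes X :: "'a topology" and f :: "'a \<Rightarrow> real"
    and Y :: "'b topology" and g :: "'b \<Rightarrow> real"
  assumes "reeb_graph X f" and "reeb_graph Y g"
  shows "(interleaving_dist X f Y g \<le> functional_distortion_dist X f Y g \<and>
          functional_distortion_dist X f Y g \<le> 7 * interleaving_dist X f Y g) \<and>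
         strongly_equivalent_on {(Z :: 'c topology, h). reeb_graph Z h}
           (\<lambda>(Z, h) (Z', h'). functional_distortion_dist Z h Z' h')
           (\<lambda>(Z, h) (Z', h'). interleaving_dist Z h Z' h')"
proof (intro conjI)
  show "interleaving_dist X f Y g \<le> functional_distortion_dist X f Y g"
    using assms by (intro interleaving_dist_le_functional_distortion_dist) (simp_all add: reeb_graph_def)
  have "functional_distortion_dist X f Y g = (7 * ennreal (1 / 7)) * functional_distortion_dist X f Y g"
    using ennreal_mult'[of 7 "1 / 7"] by simp
  also have "\<dots> \<le> 7 * interleaving_dist X f Y g"
    unfolding mult.assoc
    by (intro mult_left_mono functional_distortion_dist_le_interleaving_dist assms) simp
  finally show "functional_distortion_dist X f Y g \<le> 7 * interleaving_dist X f Y g" .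
  \<comment> \<open>The constants of the strong equivalence are \<open>1 / 7\<close> and
    \<open>1\<close>, with the functional distortion distance as the first of the two
    distances.\<close>
  have "ennreal (1 / 7) * functional_distortion_dist Z h Z' h' \<le> interleaving_dist Z h Z' h' \<and>
      interleaving_dist Z h Z' h' \<le> ennreal 1 * functional_distortion_dist Z h Z' h'"
    if "reeb_graph Z h" "reeb_graph Z' h'" for Z Z' :: "'c topology" and h h'
    using functional_distortion_dist_le_interleaving_dist[OF that]
      interleaving_dist_le_functional_distortion_dist[of Z h Z' h'] that
    by (simp add: reeb_graph_def)
  then show "strongly_equivalent_on {(Z :: 'c topology, h). reeb_graph Z h}
           (\<lambda>(Z, h) (Z', h'). functional_distortion_dist Z h Z' h')
           (\<lambda>(Z, h) (Z', h'). interleaving_dist Z h Z' h')"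
    unfolding strongly_equivalent_on_def
    by (intro exI[of _ "1 / 7"] exI[of _ 1]) auto
qed

end
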